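(* Let $d\ge2$ and let $0<p,q\le1$ satisfy $\frac1d\left(1-\frac1q\right)\ge\frac12\left(1-\frac1p\right)$. Then $$\|\mathcal{R}f\|_{L^q(d(\nu\times\sigma))}\ge\|f\|_{L^p(d\sigma)}$$ for all non-negative measurable $f$ on $\mathbb{S}^{d-1}$.
   Context: $\sigma$ is normalized surface (probability) measure on $\mathbb{S}^{d-1}$ and $\nu$ is the probability measure $d\nu(t)=\frac{|\mathbb{S}^{d-2}|}{|\mathbb{S}^{d-1}|}(1-t^2)^{\frac{d-3}{2}}dt$ on $(-1,1)$ (the pushforward of $\sigma$ under $x\mapsto x_1$). For $\omega\in\mathbb{S}^{d-1}$ and $t\in(-1,1)$, $\mathcal{R}f(\omega,t):=\int_{\mathbb{S}^{d-1}}f\,d\sigma_{\omega,t}$, where $d\sigma_{\omega,t}(x)=\frac{|\mathbb{S}^{d-1}|}{|\mathbb{S}^{d-2}|}(1-t^2)^{-\frac{d-3}{2}}\delta(x\cdot\omega-t)\,d\sigma(x)$ is the normalized average over the $(d-2)$-sphere $\mathbb{S}^{d-1}\cap\{x\cdot\omega=t\}$; equivalently, $\int_{(-1,1)}\mathcal{R}f(\omega,t)g(t)\,d\nu(t)=\int_{\mathbb{S}^{d-1}}f(x)g(x\cdot\omega)\,d\sigma(x)$ for all measurable $g\ge0$. The norm on the left is taken on $(-1,1)\times\mathbb{S}^{d-1}$ with respect to $\nu(t)\times\sigma(\omega)$. *)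

theory Defs
  imports "HOL-Analysis.Analysis"
begin

text \<open>Real powers of extended non-negative reals (used with positive exponents):
  \<open>\<infinity>\<close> to any power is \<open>\<infinity>\<close>, finite values use the real \<open>powr\<close>.\<close>
definition enn_powr :: "ennreal \<Rightarrow> real \<Rightarrow> ennreal" where
  "enn_powr x a = (if x = top then top else ennreal (enn2real x powr a))"

definition Lp_qnorm :: "'a measure \<Rightarrow> real \<Rightarrow> ('a \<Rightarrow> ennreal) \<Rightarrow> ennreal" where
  "Lp_qnorm M p g = enn_powr (\<integral>\<^sup>+ x. enn_powr (g x) p \<partial>M) (1 / p)"

text \<open>Normalized surface (probability) measure on the unit sphere of \<open>real^'n\<close>:
  the push-forward of the normalized Lebesgue measure on the unit ball under the radial
  projection \<open>x \<mapsto> x/|x|\<close> (the cone-measure description of surface measure).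
  It is a measure on \<open>real^'n\<close> concentrated on \<open>sphere 0 1\<close>.\<close>
definition sphere_sigma :: "('n::finite) itself \<Rightarrow> (real^'n) measure" where
  "sphere_sigma _ = distr (uniform_measure lborel (ball (0::real^'n) 1)) borel sgn"

text \<open>Surface area \<open>|S^(m-1)|\<close> of the unit sphere in \<open>\<real>^m\<close>.\<close>
definition sphere_area :: "nat \<Rightarrow> real" where
  "sphere_area m = 2 * pi powr (real m / 2) / Gamma (real m / 2)"

definition nu_meas :: "nat \<Rightarrow> real measure" where
  "nu_meas d = density lborel (\<lambda>t. indicator {-1<..<1} t *
      ennreal (sphere_area (d - 1) / sphere_area d * (1 - t\<^sup>2) powr ((real d - 3) / 2)))"

end

theory Submission
  imports Defs
    "HOL-Probability.Infinite_Product_Measure"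
    "HOL-Computational_Algebra.Polynomial"
begin

text \<open>
For an orthonormal frame \<open>e\<^sub>1, \<dots>, e\<^sub>d\<close> put \<open>F\<^sub>j = R e\<^sub>j\<close>, the marginals of \<open>f\<close>. The inequality of
Carlen, Lieb and Loss
\<open>\<integral> \<Prod>\<^sub>j h\<^sub>j(x \<bullet> e\<^sub>j)\<^bsup>1/2\<^esup> d\<sigma> \<le> \<Prod>\<^sub>j (\<integral> h\<^sub>j d\<nu>)\<^bsup>1/2\<^esup>\<close>, applied to \<open>h\<^sub>j = F\<^sub>j\<^bsup>q\<^esup>\<close>, and Hoelder's inequality
with weights that are powers of the \<open>F\<^sub>j\<close> give \<open>\<parallel>f\<parallel>\<^sub>p \<le> \<Prod>\<^sub>j \<parallel>F\<^sub>j\<parallel>\<^sub>q\<^bsup>1/d\<^esup>\<close> when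
\<open>1/q - 1 = (d/2) (1/p - 1)\<close>. By the arithmetic-geometric mean inequality \<open>\<parallel>f\<parallel>\<^sub>p\<^bsup>q\<^esup>\<close> is at most the mean
of the \<open>\<parallel>F\<^sub>j\<parallel>\<^sub>q\<^bsup>q\<^esup>\<close>, and averaging over random frames proves the endpoint case. The other exponents follow
from the monotonicity of the norms in \<open>q\<close>.

The Carlen--Lieb--Loss inequality is proved by letting each \<open>h\<^sub>j\<close> evolve by the ultraspherical heat flow,
along which the left-hand side increases. For polynomial \<open>h\<^sub>j\<close> the flow is a finite sum of eigenfunctions.
\<close>

section \<open>Rotation invariance of the spherical measure\<close>

text \<open>Apart from measurability, \<open>R\<close> enters only through its duality identity.
  Tested with the power \<open>q - 1\<close> of a marginal \<open>F\<close> in direction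
  \<open>e\<close>, it says that \<open>f x\<close> times this weight at
  \<open>x \<bullet> e\<close> integrates to the integral of \<open>F\<close> to the power
  \<open>q\<close>. So weights of nonpositive order close up, and conditional measures on subspheres
  never have to be constructed. The powers of the marginals that remain must be integrated without
  \<open>f\<close>, over coordinates \<open>x \<bullet> e\<close> that are dependent on the sphere.
  The Carlen--Lieb--Loss inequality stands in for independence at the price of the exponent 1/2, and
  matching the exponents produces the endpoint relation. This 1/2 is the same in every dimension
  because a rotation in a coordinate plane moves only two coordinates. Positivity has to persist
  along the flow because logarithmic derivatives of the factors occur. The arithmetic mean precedes
  the average over frames since it is linear in the integrals: then only the law of each single
  frame vector matters.\<close>

lemma emeasure_unit_ball: "emeasure lborel (ball (0::'a::euclidean_space) 1) \<noteq> 0"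
  "emeasure lborel (ball (0::'a::euclidean_space) 1) \<noteq> \<infinity>"
  by (simp_all add: emeasure_ball ennreal_eq_0_iff not_le)

lemma nn_integral_lborel_shift:
  fixes f :: "'a::euclidean_space \<Rightarrow> ennreal"
  assumes [measurable]: "f \<in> borel_measurable borel"
  shows "(\<integral>\<^sup>+ x. f (x + a) \<partial>lborel) = (\<integral>\<^sup>+ x. f x \<partial>lborel)"
proof -
  have "(\<integral>\<^sup>+ x. f x \<partial>lborel) = (\<integral>\<^sup>+ x. f x \<partial>(distr lborel borel ((+) a)))"
    by (simp add: lborel_distr_plus)
  also have "\<dots> = (\<integral>\<^sup>+ x. f (a + x) \<partial>lborel)"
    by (rule nn_integral_distr) auto
  finally show ?thesis by (simp add: add.commute)
qed

lemma orthogonal_transformation_borel: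
  "orthogonal_transformation (T :: 'a::euclidean_space \<Rightarrow> 'a) \<Longrightarrow> T \<in> borel_measurable borel"
  by (intro borel_measurable_continuous_onI linear_continuous_on
      linear_conv_bounded_linear[THEN iffD1] orthogonal_transformation_linear)

lemma orthogonal_transformation_inv_ex:
  fixes T :: "'a::euclidean_space \<Rightarrow> 'a"
  assumes "orthogonal_transformation T"
  obtains S where "orthogonal_transformation S" "\<And>x. S (T x) = x" "\<And>x. T (S x) = x"
  using orthogonal_transformation_inv[OF assms] orthogonal_transformation_inj[OF assms]
    orthogonal_transformation_surj[OF assms] by (metis inv_f_f surj_f_inv_f)

text \<open>Both \<open>lborel\<close> and its image are translation invariant. Integrating
  \<open>1\<^sub>A x * 1\<^sub>B (y - x)\<close>, with \<open>B\<close> the unit ball, in both orders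
  against the product of the two measures shows that they agree on \<open>A\<close>.\<close>

lemma distr_lborel_orthogonal:
  fixes T :: "'a::euclidean_space \<Rightarrow> 'a"
  assumes T: "orthogonal_transformation T"
  shows "distr lborel borel T = lborel"
proof -
  have Tm[measurable]: "T \<in> borel_measurable borel"
    using T by (rule orthogonal_transformation_borel)
  obtain S where S: "orthogonal_transformation S" "\<And>x. S (T x) = x" "\<And>x. T (S x) = x"
    using orthogonal_transformation_inv_ex[OF T] by blast
  define B :: "'a set" where "B = ball 0 1"
  have B[measurable]: "B \<in> sets borel" by (simp add: B_def)
  define b where "b = emeasure lborel B"
  have b: "b \<noteq> 0" "b \<noteq> \<infinity>"
    unfolding b_def B_def using emeasure_unit_ball[where 'a='a] by auto
  have normT: "norm (T x) = norm x" for x using T by (simp add: orthogonal_transformation)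
  have add: "T (x + y) = T x + T y" for x y
    using orthogonal_transformation_linear[OF T] by (simp add: linear_add)
  show ?thesis
  proof (rule measure_eqI)
    fix A assume "A \<in> sets (distr lborel borel T)"
    then have A[measurable]: "A \<in> sets borel" by simp
    have "emeasure (distr lborel borel T) A * b = (\<integral>\<^sup>+ x. indicator A (T x) * b \<partial>lborel)"
    proof -
      have "emeasure (distr lborel borel T) A = (\<integral>\<^sup>+ x. indicator A x \<partial>distr lborel borel T)"
        by simp
      also have "\<dots> = (\<integral>\<^sup>+ x. indicator A (T x) \<partial>lborel)"
        by (rule nn_integral_distr) auto
      finally show ?thesis by (simp add: nn_integral_multc)
    qed
    also have "\<dots> = (\<integral>\<^sup>+ x. (\<integral>\<^sup>+ y. indicator A (T x) * indicator B (y - T x) \<partial>lborel) \<partial>lborel)"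
    proof (rule nn_integral_cong)
      fix x
      have "(\<integral>\<^sup>+ y. indicator A (T x) * indicator B (y - T x) \<partial>lborel)
          = indicator A (T x) * (\<integral>\<^sup>+ y. indicator B (y + (- T x)) \<partial>lborel)"
        by (simp add: nn_integral_cmult)
      also have "(\<integral>\<^sup>+ y. indicator B (y + (- T x)) \<partial>lborel) = b"
        by (subst nn_integral_lborel_shift) (auto simp: b_def)
      finally show "indicator A (T x) * b = (\<integral>\<^sup>+ y. indicator A (T x) * indicator B (y - T x) \<partial>lborel)"
        by simp
    qed
    also have "\<dots> = (\<integral>\<^sup>+ y. (\<integral>\<^sup>+ x. indicator A (T x) * indicator B (y - T x) \<partial>lborel) \<partial>lborel)"
      by (rule lborel_pair.Fubini') simp
    \<comment> \<open>Substituting \<open>x + S y\<close> for \<open>x\<close> turns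
      \<open>T x\<close> into \<open>T x + y\<close>, so that \<open>y\<close> survives only in the
      indicator of \<open>A\<close>.\<close>
    also have "\<dots> = (\<integral>\<^sup>+ y. (\<integral>\<^sup>+ x. indicator A (T x + y) * indicator B (- T x) \<partial>lborel) \<partial>lborel)"
    proof (rule nn_integral_cong)
      fix y
      show "(\<integral>\<^sup>+ x. indicator A (T x) * indicator B (y - T x) \<partial>lborel)
          = (\<integral>\<^sup>+ x. indicator A (T x + y) * indicator B (- T x) \<partial>lborel)"
        by (subst nn_integral_lborel_shift[of _ "S y", symmetric]) (auto simp: add S)
    qed
    also have "\<dots> = (\<integral>\<^sup>+ x. (\<integral>\<^sup>+ y. indicator A (T x + y) * indicator B (- T x) \<partial>lborel) \<partial>lborel)"
      by (rule lborel_pair.Fubini') simp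
    also have "\<dots> = (\<integral>\<^sup>+ x. emeasure lborel A * indicator B x \<partial>lborel)"
    proof (rule nn_integral_cong)
      fix x
      have "(\<integral>\<^sup>+ y. indicator A (T x + y) * indicator B (- T x) \<partial>lborel)
          = (\<integral>\<^sup>+ y. indicator A (y + T x) \<partial>lborel) * indicator B (- T x)"
        by (simp add: nn_integral_multc add.commute)
      also have "\<dots> = emeasure lborel A * indicator B x"
        by (subst nn_integral_lborel_shift) (auto simp: B_def indicator_def normT)
      finally show "(\<integral>\<^sup>+ y. indicator A (T x + y) * indicator B (- T x) \<partial>lborel)
          = emeasure lborel A * indicator B x" .
    qed
    also have "\<dots> = emeasure lborel A * b"
      by (simp add: nn_integral_cmult b_def)
    finally show "emeasure (distr lborel borel T) A = emeasure lborel A"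
      using b by (auto simp: mult.commute[of _ b] ennreal_mult_cancel_left)
  qed simp
qed

text \<open>One measure serves twice: its radial projection is \<open>sphere_sigma\<close>, and
  independent samples of it are the vectors from which random frames are built.\<close>

definition unit_ball_unif :: "'a::euclidean_space measure" where
  "unit_ball_unif = uniform_measure lborel (ball 0 1)"

lemma sets_unit_ball_unif [measurable_cong, simp]: "sets unit_ball_unif = sets borel"
  by (simp add: unit_ball_unif_def)

lemma space_unit_ball_unif [simp]: "space unit_ball_unif = UNIV"
  by (simp add: unit_ball_unif_def)

lemma prob_space_unit_ball_unif: "prob_space (unit_ball_unif :: 'a::euclidean_space measure)"
  unfolding unit_ball_unif_def
  by (rule prob_space_uniform_measure) (use emeasure_unit_ball[where 'a='a] in auto)

lemma distr_unit_ball_unif_orthogonal: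
  fixes T :: "'a::euclidean_space \<Rightarrow> 'a"
  assumes T: "orthogonal_transformation T"
  shows "distr unit_ball_unif borel T = unit_ball_unif"
proof (rule measure_eqI)
  have [measurable]: "T \<in> borel_measurable borel"
    using T by (rule orthogonal_transformation_borel)
  fix A assume "A \<in> sets (distr unit_ball_unif borel T)"
  then have A[measurable]: "A \<in> sets borel" by simp
  have normT: "norm (T x) = norm x" for x using T by (simp add: orthogonal_transformation)
  have "emeasure lborel (ball 0 1 \<inter> T -` A) = emeasure lborel (T -` (ball 0 1 \<inter> A) \<inter> space lborel)"
    by (rule arg_cong[where f="emeasure lborel"]) (auto simp: normT)
  also have "\<dots> = emeasure (distr lborel borel T) (ball 0 1 \<inter> A)"
    by (rule emeasure_distr[symmetric]) auto
  finally have "emeasure lborel (ball 0 1 \<inter> T -` A) = emeasure lborel (ball 0 1 \<inter> A)"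
    using T by (simp add: distr_lborel_orthogonal)
  moreover have "T -` A \<in> sets borel" using measurable_sets[of T borel borel A] by auto
  ultimately show "emeasure (distr unit_ball_unif borel T) A = emeasure unit_ball_unif A"
    by (simp add: emeasure_distr) (simp add: unit_ball_unif_def)
qed simp

lemma sgn_borel_measurable [measurable]: "sgn \<in> borel_measurable (borel :: 'a::euclidean_space measure)"
  unfolding sgn_div_norm[abs_def] by measurable

lemma sphere_sigma_eq: "sphere_sigma TYPE('n::finite) = distr unit_ball_unif borel sgn"
  by (simp add: sphere_sigma_def unit_ball_unif_def)

lemma sets_sphere_sigma [measurable_cong, simp]: "sets (sphere_sigma TYPE('n::finite)) = sets borel"
  by (simp add: sphere_sigma_def)

lemma space_sphere_sigma [simp]: "space (sphere_sigma TYPE('n::finite)) = UNIV"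
  by (simp add: sphere_sigma_def)

lemma prob_space_sphere_sigma: "prob_space (sphere_sigma TYPE('n::finite))"
  unfolding sphere_sigma_eq
  by (intro prob_space.prob_space_distr prob_space_unit_ball_unif) simp

text \<open>Since \<open>sgn 0 = 0\<close>, only the origin fails to be sent to the sphere, and it
  is a null set.\<close>

lemma AE_sphere_sigma: "AE x in sphere_sigma TYPE('n::finite). norm x = 1"
proof -
  have "AE x in lborel. x \<noteq> (0::real^'n)"
    by (rule AE_lborel_singleton)
  then have "AE x in unit_ball_unif. x \<noteq> (0::real^'n)"
    unfolding unit_ball_unif_def
    by (intro AE_uniform_measureI) auto
  then show ?thesis
    unfolding sphere_sigma_eq
    by (subst AE_distr_iff) (auto simp: norm_sgn)
qed

lemma distr_sphere_sigma_orthogonal: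
  fixes T :: "real^'n \<Rightarrow> real^'n"
  assumes T: "orthogonal_transformation T"
  shows "distr (sphere_sigma TYPE('n)) borel T = sphere_sigma TYPE('n)"
proof -
  have [measurable]: "T \<in> borel_measurable borel"
    using T by (rule orthogonal_transformation_borel)
  have "distr (sphere_sigma TYPE('n)) borel T = distr unit_ball_unif borel (T \<circ> sgn)"
    unfolding sphere_sigma_eq by (rule distr_distr) auto
  also have "T \<circ> sgn = sgn \<circ> T"
    using T by (auto simp: fun_eq_iff sgn_div_norm orthogonal_transformation
        linear_cmul)
  also have "distr unit_ball_unif borel (sgn \<circ> T) = distr (distr unit_ball_unif borel T) borel sgn"
    by (rule distr_distr[symmetric]) auto
  finally show ?thesis
    using T by (simp add: distr_unit_ball_unif_orthogonal sphere_sigma_eq)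
qed

lemma nn_integral_sphere_sigma_orthogonal:
  fixes T :: "real^'n \<Rightarrow> real^'n"
  assumes T: "orthogonal_transformation T" and [measurable]: "f \<in> borel_measurable borel"
  shows "(\<integral>\<^sup>+ x. f (T x) \<partial>sphere_sigma TYPE('n)) = (\<integral>\<^sup>+ x. f x \<partial>sphere_sigma TYPE('n))"
proof -
  have [measurable]: "T \<in> borel_measurable borel"
    using T by (rule orthogonal_transformation_borel)
  have "(\<integral>\<^sup>+ x. f x \<partial>distr (sphere_sigma TYPE('n)) borel T) = (\<integral>\<^sup>+ x. f (T x) \<partial>sphere_sigma TYPE('n))"
    by (rule nn_integral_distr) auto
  then show ?thesis by (simp add: distr_sphere_sigma_orthogonal[OF T])
qed

lemma integral_sphere_sigma_orthogonal:
  fixes T :: "real^'n \<Rightarrow> real^'n" and f :: "real^'n \<Rightarrow> real"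
  assumes T: "orthogonal_transformation T" and [measurable]: "f \<in> borel_measurable borel"
  shows "(\<integral> x. f (T x) \<partial>sphere_sigma TYPE('n)) = (\<integral> x. f x \<partial>sphere_sigma TYPE('n))"
proof -
  have [measurable]: "T \<in> borel_measurable borel"
    using T by (rule orthogonal_transformation_borel)
  have "(\<integral> x. f x \<partial>distr (sphere_sigma TYPE('n)) borel T) = (\<integral> x. f (T x) \<partial>sphere_sigma TYPE('n))"
    by (rule integral_distr) auto
  then show ?thesis by (simp add: distr_sphere_sigma_orthogonal[OF T])
qed

section \<open>Integration by parts on the sphere\<close>

text \<open>Fubini replaces differentiation under the integral sign, since only increments between
  two parameter values are required. The parameter will be a rotation angle and then the heat
  time.\<close>

lemma integral_FTC_param:
  fixes M :: "'a::{second_countable_topology,metric_space} measure" and g D :: "real \<Rightarrow> 'a \<Rightarrow> real"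
  assumes M: "finite_measure M" "sets M = sets borel" and K: "compact K" "AE x in M. x \<in> K"
    and ab: "a \<le> b"
    and deriv: "\<And>x t. x \<in> K \<Longrightarrow> a \<le> t \<Longrightarrow> t \<le> b \<Longrightarrow>
      ((\<lambda>t. g t x) has_field_derivative D t x) (at t)"
    and cont: "continuous_on ({a..b} \<times> K) (\<lambda>z. D (fst z) (snd z))"
    and meas: "g a \<in> borel_measurable borel" "g b \<in> borel_measurable borel"
      "\<And>t. D t \<in> borel_measurable borel"
  shows "(\<integral>x. g b x - g a x \<partial>M) = (\<integral>t. indicator {a..b} t * (\<integral>x. D t x \<partial>M) \<partial>lborel)"
proof -
  note M(2)[measurable_cong]
  note meas[measurable]
  interpret M: finite_measure M by fact
  interpret P: pair_sigma_finite lborel M ..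
  \<comment> \<open>Off \<open>K\<close> nothing is known about the size of \<open>D\<close>.
    Cutting off at a compact set gives a bounded integrand that is jointly measurable by
    continuity.\<close>
  define E where "E = (\<lambda>z. indicator ({a..b} \<times> K) z * D (fst z) (snd z))"
  have cK: "compact ({a..b} \<times> K)" by (intro compact_Times K) simp
  have "E \<in> borel_measurable borel"
    unfolding E_def
    using borel_measurable_continuous_on_indicator[OF _ cont] borel_closed[OF compact_imp_closed[OF cK]]
    by simp
  then have E[measurable]: "E \<in> borel_measurable (lborel \<Otimes>\<^sub>M M)"
    by (simp add: borel_prod[symmetric] cong: measurable_cong_sets
        sets_pair_measure_cong[OF sets_lborel M(2)])
  obtain B where B: "\<And>z. z \<in> {a..b} \<times> K \<Longrightarrow> \<bar>D (fst z) (snd z)\<bar> \<le> B"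
    using compact_imp_bounded[OF compact_continuous_image[OF cont cK]]
    by (force simp: bounded_iff)
  have int: "integrable (lborel \<Otimes>\<^sub>M M) E"
  proof (rule Bochner_Integration.integrable_bound)
    have sM: "UNIV \<in> sets M" using sets_eq_imp_space_eq[OF M(2)] sets.top[of M] by simp
    have "emeasure (lborel \<Otimes>\<^sub>M M) ({a..b} \<times> UNIV) = ennreal (b - a) * emeasure M UNIV"
      using ab sM by (simp add: M.emeasure_pair_measure_Times)
    also have "\<dots> < \<infinity>"
      using M.emeasure_finite[of UNIV] ennreal_mult_less_top[of "ennreal (b - a)" "emeasure M UNIV"]
      by (simp only: infinity_ennreal_def top.not_eq_extremum ennreal_less_top simp_thms)
    finally show "integrable (lborel \<Otimes>\<^sub>M M) (\<lambda>z. B * indicator ({a..b} \<times> UNIV) z)"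
      using sM by (intro integrable_mult_right integrable_real_indicator pair_measureI) auto
    show "AE z in lborel \<Otimes>\<^sub>M M. norm (E z) \<le> norm (B * indicator ({a..b} \<times> UNIV) z)"
    proof (rule AE_I2)
      fix z
      show "norm (E z) \<le> norm (B * indicator ({a..b} \<times> UNIV) z)"
      proof (cases "z \<in> {a..b} \<times> K")
        case True
        then have "E z = D (fst z) (snd z)" "indicator ({a..b} \<times> UNIV) z = (1::real)"
          by (auto simp: E_def indicator_def)
        then show ?thesis using B[OF True] by simp
      qed (simp add: E_def)
    qed
  qed fact
  have inner: "(\<integral>t. E (t, x) \<partial>lborel) = g b x - g a x" if "x \<in> K" for x
  proof -
    have c: "continuous_on {a..b} (\<lambda>t. D t x)"
      by (rule continuous_on_compose2[OF cont, of _ "\<lambda>t. (t, x)", simplified])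
        (auto intro!: continuous_intros that)
    have "(\<integral>t. indicator {a..b} t *\<^sub>R D t x \<partial>lborel) = g b x - g a x"
      by (intro integral_FTC_Icc ab c)
        (use deriv[OF that] in \<open>auto simp: has_real_derivative_iff_has_vector_derivative
          intro: has_vector_derivative_at_within\<close>)
    moreover have "(\<lambda>t. E (t, x)) = (\<lambda>t. indicator {a..b} t *\<^sub>R D t x)"
      using that by (auto simp: E_def indicator_def)
    ultimately show ?thesis by simp
  qed
  have "(\<integral>x. g b x - g a x \<partial>M) = (\<integral>x. (\<integral>t. E (t, x) \<partial>lborel) \<partial>M)"
  proof (rule integral_cong_AE)
    show "AE x in M. g b x - g a x = (\<integral>t. E (t, x) \<partial>lborel)"
      using K(2) by eventually_elim (simp add: inner)
    show "(\<lambda>x. g b x - g a x) \<in> borel_measurable M" by measurable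
    show "(\<lambda>x. \<integral>t. E (t, x) \<partial>lborel) \<in> borel_measurable M"
      by (rule borel_measurable_integrable[OF P.integrable_snd])
        (use int in \<open>simp add: case_prod_beta'\<close>)
  qed
  also have "\<dots> = (\<integral>t. (\<integral>x. E (t, x) \<partial>M) \<partial>lborel)"
    by (rule P.Fubini_integral) (use int in \<open>simp add: case_prod_beta'\<close>)
  also have "\<dots> = (\<integral>t. indicator {a..b} t * (\<integral>x. D t x \<partial>M) \<partial>lborel)"
  proof (rule Bochner_Integration.integral_cong[OF refl])
    fix t
    have "(\<integral>x. E (t, x) \<partial>M) = (\<integral>x. indicator {a..b} t * D t x \<partial>M)"
    proof (rule integral_cong_AE)
      show "AE x in M. E (t, x) = indicator {a..b} t * D t x"
        using K(2) by eventually_elim (simp add: E_def indicator_def)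
      show "(\<lambda>x. E (t, x)) \<in> borel_measurable M"
        using measurable_compose[OF measurable_Pair1' E, of t] by simp
      show "(\<lambda>x. indicator {a..b} t * D t x) \<in> borel_measurable M" by measurable
    qed
    then show "(\<integral>x. E (t, x) \<partial>M) = indicator {a..b} t * (\<integral>x. D t x \<partial>M)" by simp
  qed
  finally show ?thesis .
qed

text \<open>For \<open>i \<noteq> j\<close> this is the flow of the vector field
  \<open>x_j d/dx_i - x_i d/dx_j\<close>; the orientation is chosen so that the \<open>i\<close>-th
  coordinate has derivative \<open>x_j\<close>.\<close>

definition plane_rot :: "'n \<Rightarrow> 'n \<Rightarrow> real \<Rightarrow> real^'n \<Rightarrow> real^'n::finite" where
  "plane_rot i j \<theta> x = (\<chi> k. if k = i then cos \<theta> * x $ i + sin \<theta> * x $ j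
     else if k = j then cos \<theta> * x $ j - sin \<theta> * x $ i else x $ k)"

lemma orthogonal_transformation_plane_rot:
  assumes "i \<noteq> j"
  shows "orthogonal_transformation (plane_rot i j \<theta> :: real^'n::finite \<Rightarrow> real^'n)"
  unfolding orthogonal_transformation
proof (intro conjI allI)
  show "linear (plane_rot i j \<theta> :: real^'n \<Rightarrow> real^'n)"
    by (rule linearI) (auto simp: plane_rot_def vec_eq_iff algebra_simps)
  fix x :: "real^'n"
  have split: "(\<Sum>k\<in>UNIV. (f k)\<^sup>2) = (f i)\<^sup>2 + (f j)\<^sup>2 + (\<Sum>k\<in>UNIV - {i} - {j}. (f k)\<^sup>2)" for f :: "'n \<Rightarrow> real"
    using assms by (subst sum.remove[of _ i], simp, simp, subst sum.remove[of _ j]) auto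
  have "(cos \<theta> * a + sin \<theta> * b)\<^sup>2 + (cos \<theta> * b - sin \<theta> * a)\<^sup>2 = a\<^sup>2 + b\<^sup>2" for a b
  proof -
    have "(cos \<theta> * a + sin \<theta> * b)\<^sup>2 + (cos \<theta> * b - sin \<theta> * a)\<^sup>2 = ((sin \<theta>)\<^sup>2 + (cos \<theta>)\<^sup>2) * (a\<^sup>2 + b\<^sup>2)"
      by (simp only: power2_eq_square) algebra
    then show ?thesis by simp
  qed
  then have "(\<Sum>k\<in>UNIV. (plane_rot i j \<theta> x $ k)\<^sup>2) = (\<Sum>k\<in>UNIV. (x $ k)\<^sup>2)"
    unfolding split using assms by (auto simp: plane_rot_def)
  then show "norm (plane_rot i j \<theta> x) = norm x"
    by (simp add: norm_vec_def L2_set_def)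
qed

lemma DERIV_plane_rot:
  assumes "i \<noteq> j"
  shows "((\<lambda>\<theta>. plane_rot i j \<theta> x $ k) has_field_derivative
     (if k = i then plane_rot i j \<theta> x $ j else if k = j then - (plane_rot i j \<theta> x $ i) else 0)) (at \<theta>)"
  using assms by (auto simp: plane_rot_def intro!: derivative_eq_intros)

lemma continuous_on_plane_rot: "continuous_on A (\<lambda>z. plane_rot i j (fst z) (snd z))"
proof -
  have "continuous_on A (\<lambda>z. plane_rot i j (fst z) (snd z) $ k)" for k
    by (cases "k = i"; cases "k = j") (auto simp: plane_rot_def intro!: continuous_intros)
  then show ?thesis
    using continuous_on_vec_lambda[of A "\<lambda>k z. plane_rot i j (fst z) (snd z) $ k"] by simp
qed

text \<open>Integration by parts from invariance alone: a full turn returns to the starting point,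
  while the mean of \<open>D\<close> is the same at every angle, so \<open>2 * pi\<close> times that
  mean is the total change 0.\<close>

lemma integral_rotation_derivative:
  fixes \<psi> D :: "real^'n \<Rightarrow> real"
  assumes ij: "i \<noteq> j" and D: "continuous_on (sphere 0 1) D" "D \<in> borel_measurable borel"
    and \<psi>: "\<psi> \<in> borel_measurable borel"
    and deriv: "\<And>x \<theta>. norm x = 1 \<Longrightarrow>
      ((\<lambda>\<theta>. \<psi> (plane_rot i j \<theta> x)) has_field_derivative D (plane_rot i j \<theta> x)) (at \<theta>)"
  shows "(\<integral>x. D x \<partial>sphere_sigma TYPE('n)) = 0"
proof -
  let ?S = "sphere_sigma TYPE('n)"
  interpret prob_space ?S by (rule prob_space_sphere_sigma)
  note D(2)[measurable] \<psi>[measurable]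
  note ot = orthogonal_transformation_plane_rot[OF ij]
  have [measurable]: "plane_rot i j \<theta> \<in> borel_measurable borel" for \<theta>
    by (rule orthogonal_transformation_borel[OF ot])
  have n: "norm (plane_rot i j \<theta> x) = norm x" for \<theta> x
    using ot[of \<theta>] by (simp add: orthogonal_transformation)
  have period: "plane_rot i j (2*pi) x = plane_rot i j 0 x" for x
    by (simp add: plane_rot_def vec_eq_iff)
  have "0 = (\<integral>x. \<psi> (plane_rot i j (2*pi) x) - \<psi> (plane_rot i j 0 x) \<partial>?S)"
    by (simp add: period)
  also have "\<dots> = (\<integral>t. indicator {0..2*pi} t * (\<integral>x. D (plane_rot i j t x) \<partial>?S) \<partial>lborel)"
  proof (rule integral_FTC_param[where K="sphere 0 1"])
    show "finite_measure ?S" by unfold_locales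
    show "AE x in ?S. x \<in> sphere 0 1" using AE_sphere_sigma by simp
    show "continuous_on ({0..2 * pi} \<times> sphere 0 1) (\<lambda>z. D (plane_rot i j (fst z) (snd z)))"
      by (rule continuous_on_compose2[OF D(1) continuous_on_plane_rot]) (auto simp: n)
  qed (use deriv in auto)
  also have "\<dots> = (\<integral>t. indicator {0..2*pi} t * (\<integral>x. D x \<partial>?S) \<partial>lborel)"
    by (simp add: integral_sphere_sigma_orthogonal[OF ot])
  also have "\<dots> = 2 * pi * (\<integral>x. D x \<partial>?S)"
    by simp
  finally show ?thesis by simp
qed

section \<open>The ultraspherical operator and its heat flow\<close>

lemma borel_measurable_poly [measurable]: "poly p \<in> borel_measurable (borel :: real measure)"
  by (intro borel_measurable_continuous_onI continuous_intros)

text \<open>The Laplace--Beltrami operator of the unit sphere in dimension \<open>d\<close>, acting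
  on functions of one coordinate. Its polynomial eigenfunctions are Gegenbauer polynomials,
  Chebyshev polynomials for \<open>d = 2\<close>.\<close>

definition geg :: "nat \<Rightarrow> real poly \<Rightarrow> real poly" where
  "geg d p = [:1, 0, -1:] * pderiv (pderiv p) - smult (real d - 1) ([:0, 1:] * pderiv p)"

lemma poly_geg: "poly (geg d p) x
    = (1 - x\<^sup>2) * poly (pderiv (pderiv p)) x - (real d - 1) * x * poly (pderiv p) x"
  by (simp add: geg_def power2_eq_square algebra_simps)

lemma geg_0 [simp]: "geg d 0 = 0"
  by (simp add: geg_def)

lemma geg_add: "geg d (p + q) = geg d p + geg d q"
  by (simp add: geg_def pderiv_add algebra_simps smult_add_right)

lemma geg_diff: "geg d (p - q) = geg d p - geg d q"
  by (simp add: geg_def pderiv_diff algebra_simps smult_diff_right)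

lemma geg_smult: "geg d (smult c p) = smult c (geg d p)"
  unfolding geg_def pderiv_smult mult_smult_right smult_diff_right smult_smult
  by (simp only: mult.commute)

lemma geg_sum: "geg d (sum f A) = (\<Sum>i\<in>A. geg d (f i))"
  by (induction A rule: infinite_finite_induct) (auto simp: geg_add)

lemma smult_sum_right: "smult c (sum f A) = (\<Sum>i\<in>A. smult c (f i :: real poly))"
  by (induction A rule: infinite_finite_induct) (auto simp: smult_add_right)

definition geg_ev :: "nat \<Rightarrow> nat \<Rightarrow> real" where
  "geg_ev d n = real n * (real n + real d - 2)"

text \<open>In the monomial basis the operator is triangular with diagonal entries
  \<open>- geg_ev d n\<close>. As these are distinct for \<open>d \<ge> 2\<close>, it can be
  diagonalized on polynomials of bounded degree.\<close>

lemma coeff_geg: "coeff (geg d p) n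
    = (real n + 2) * (real n + 1) * coeff p (n + 2) - geg_ev d n * coeff p n"
proof (cases n)
  case 0
  then show ?thesis
    by (simp add: geg_def geg_ev_def coeff_pderiv numeral_2_eq_2)
next
  case (Suc m)
  show ?thesis
    by (cases m) (simp_all add: Suc geg_def geg_ev_def coeff_pderiv numeral_2_eq_2 algebra_simps)
qed

lemma geg_ev_pos: "d \<ge> 2 \<Longrightarrow> n > 0 \<Longrightarrow> geg_ev d n > 0"
  by (simp add: geg_ev_def)

lemma geg_ev_strict: "d \<ge> 2 \<Longrightarrow> n < m \<Longrightarrow> geg_ev d n < geg_ev d m"
  unfolding geg_ev_def
  by (intro mult_strict_mono') auto

text \<open>\<open>geg d + geg_ev d (N + 1)\<close> lowers the degree of a polynomial of degree \<open>N + 1\<close>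
  and is invertible on polynomials of degree at most \<open>N\<close>.\<close>

lemma geg_eigen_decomp:
  assumes d: "d \<ge> 2" and "degree p \<le> N"
  shows "\<exists>e. (\<forall>n. geg d (e n) = smult (- geg_ev d n) (e n)) \<and> degree (e 0) = 0 \<and> p = (\<Sum>n\<le>N. e n)"
  using assms(2)
proof (induction N arbitrary: p)
  case 0
  then have "pderiv p = 0" by (simp add: pderiv_eq_0_iff)
  with 0 show ?case
    by (intro exI[of _ "\<lambda>n. if n = 0 then p else 0"]) (auto simp: geg_ev_def geg_def)
next
  case (Suc N)
  let ?l = "geg_ev d (Suc N)"
  define p' where "p' = geg d p + smult ?l p"
  have "degree p' \<le> N"
  proof (rule degree_le, intro allI impI)
    fix i assume "N < i"
    then consider "i = Suc N" | "i > Suc N" by linarith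
    then show "coeff p' i = 0"
    proof cases
      case 1
      moreover have "coeff p (i + 2) = 0"
        using Suc.prems 1 by (intro coeff_eq_0) auto
      ultimately show ?thesis
        by (simp add: p'_def coeff_geg)
    next
      case 2
      moreover have "coeff p (i + 2) = 0" "coeff p i = 0"
        using Suc.prems 2 by (auto intro!: coeff_eq_0)
      ultimately show ?thesis
        by (simp add: p'_def coeff_geg)
    qed
  qed
  from Suc.IH[OF this] obtain e where
    e: "\<And>n. geg d (e n) = smult (- geg_ev d n) (e n)" "degree (e 0) = 0" "p' = (\<Sum>n\<le>N. e n)"
    by blast
  \<comment> \<open>On \<open>e n\<close> the operator \<open>geg d + ?l\<close> is multiplication
    by \<open>?l - geg_ev d n\<close>, which is positive for \<open>n \<le> N\<close>. Dividing by
    it gives a preimage \<open>q\<close> of \<open>p'\<close>, and \<open>p - q\<close>, which lies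
    in the kernel, is the missing eigenfunction.\<close>
  define h where "h = (\<lambda>n. smult (1 / (?l - geg_ev d n)) (e n))"
  define q where "q = (\<Sum>n\<le>N. h n)"
  have h: "geg d (h n) = smult (- geg_ev d n) (h n)" for n
    by (simp add: h_def geg_smult e(1) mult.commute)
  have "geg d q + smult ?l q = (\<Sum>n\<le>N. e n)"
    unfolding q_def geg_sum smult_sum_right sum.distrib[symmetric]
  proof (rule sum.cong[OF refl])
    fix n assume "n \<in> {..N}"
    then have "geg_ev d n < ?l" using geg_ev_strict[OF d] by auto
    moreover have "geg d (h n) + smult ?l (h n) = smult (?l - geg_ev d n) (h n)"
      by (simp add: h smult_diff_left)
    ultimately show "geg d (h n) + smult ?l (h n) = e n"
      by (simp add: h_def)
  qed
  then have eq: "geg d (p - q) = smult (- ?l) (p - q)"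
    using e(3) by (simp add: p'_def geg_diff smult_diff_right algebra_simps)
  show ?case
  proof (intro exI[of _ "\<lambda>n. if n \<le> N then h n else if n = Suc N then p - q else 0"] conjI allI)
    fix n
    show "geg d (if n \<le> N then h n else if n = Suc N then p - q else 0)
        = smult (- geg_ev d n) (if n \<le> N then h n else if n = Suc N then p - q else 0)"
      using h eq by simp
    show "degree (if 0 \<le> N then h 0 else if 0 = Suc N then p - q else 0) = 0"
      using e(2) by (simp add: h_def)
    have "(\<Sum>n\<le>Suc N. if n \<le> N then h n else if n = Suc N then p - q else 0) = q + (p - q)"
      unfolding sum.atMost_Suc q_def by (intro arg_cong2[where f="(+)"] sum.cong) auto
    then show "p = (\<Sum>n\<le>Suc N. if n \<le> N then h n else if n = Suc N then p - q else 0)"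
      by simp
  qed
qed

text \<open>The solution of the heat equation \<open>\<partial>\<^sub>t u = geg d u\<close> with initial datum
  \<open>\<Sum>n\<le>N. e n\<close>, for eigenfunctions \<open>e n\<close>.\<close>

definition heat :: "nat \<Rightarrow> nat \<Rightarrow> (nat \<Rightarrow> real poly) \<Rightarrow> real \<Rightarrow> real poly" where
  "heat d N e t = (\<Sum>n\<le>N. smult (exp (- geg_ev d n * t)) (e n))"

lemma poly_heat: "poly (heat d N e t) x = (\<Sum>n\<le>N. exp (- geg_ev d n * t) * poly (e n) x)"
  by (simp add: heat_def poly_sum)

lemma poly_geg_heat:
  assumes "\<And>n. geg d (e n) = smult (- geg_ev d n) (e n)"
  shows "poly (geg d (heat d N e t)) x = (\<Sum>n\<le>N. - geg_ev d n * exp (- geg_ev d n * t) * poly (e n) x)"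
  by (simp add: heat_def geg_sum geg_smult assms poly_sum mult_ac)

lemma DERIV_heat:
  assumes "\<And>n. geg d (e n) = smult (- geg_ev d n) (e n)"
  shows "((\<lambda>t. poly (heat d N e t) x) has_field_derivative poly (geg d (heat d N e t)) x) (at t)"
  unfolding poly_geg_heat[OF assms] unfolding poly_heat
  by (auto intro!: derivative_eq_intros sum.cong simp: mult_ac)

lemma second_deriv_nonneg_at_min:
  fixes p :: "real poly"
  assumes x: "-1 < x" "x < 1" and min: "\<And>y. y \<in> {-1..1} \<Longrightarrow> poly p x \<le> poly p y"
  shows "poly (pderiv p) x = 0" "poly (pderiv (pderiv p)) x \<ge> 0"
proof -
  define e where "e = min (1 - x) (x + 1)"
  have e: "e > 0" using x by (auto simp: e_def)
  show z: "poly (pderiv p) x = 0"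
    by (rule DERIV_local_min[OF poly_DERIV e]) (use min in \<open>auto simp: e_def abs_less_iff\<close>)
  show "poly (pderiv (pderiv p)) x \<ge> 0"
  proof (rule ccontr)
    assume "\<not> ?thesis"
    from DERIV_neg_dec_right[OF poly_DERIV] this
    obtain r where r: "r > 0" "\<And>h. 0 < h \<Longrightarrow> h < r \<Longrightarrow> poly (pderiv p) (x + h) < 0"
      using z by (metis not_le)
    define y where "y = x + min (r / 2) (e / 2)"
    have y: "x < y" "y < x + r" "y < x + e" using r e by (auto simp: y_def)
    obtain w where w: "x < w" "w < y" "poly p y - poly p x = (y - x) * poly (pderiv p) w"
      using MVT2[OF y(1), of "poly p" "poly (pderiv p)"] poly_DERIV by blast
    have "poly (pderiv p) w < 0"
      using r(2)[of "w - x"] w y by simp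
    then have "poly p y < poly p x" using w y by (smt (verit) mult_pos_neg)
    moreover have "y \<in> {-1..1}" using y x by (auto simp: e_def min_def split: if_splits)
    ultimately show False using min by fastforce
  qed
qed

text \<open>A minimum at an endpoint may fail to be critical, but there the second-order coefficient
  vanishes and the drift points into the interval, so the first-order term has the right sign. The
  maximum principle thus holds up to the boundary.\<close>

lemma geg_nonneg_at_min:
  assumes d: "d \<ge> 2" and x: "x \<in> {-1..1}" and min: "\<And>y. y \<in> {-1..1} \<Longrightarrow> poly p x \<le> poly p y"
  shows "poly (geg d p) x \<ge> 0"
proof -
  consider "-1 < x" "x < 1" | "x = 1" | "x = -1" using x by fastforce
  then show ?thesis
  proof cases
    case 1
    then have "x\<^sup>2 \<le> 1" by (simp add: abs_square_le_1)
    then show ?thesis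
      using second_deriv_nonneg_at_min[OF 1 min] by (simp add: poly_geg)
  next
    case 2
    have "poly (pderiv p) x \<le> 0"
    proof (rule ccontr)
      assume "\<not> ?thesis"
      then obtain r where r: "r > 0" "\<And>h. 0 < h \<Longrightarrow> h < r \<Longrightarrow> poly p (x - h) < poly p x"
        using DERIV_pos_inc_left[OF poly_DERIV, of p x] by (auto simp: not_le)
      define h where "h = min (r / 2) 1"
      have "0 < h" "h < r" "h \<le> 1" using r(1) by (auto simp: h_def)
      then show False
        using r(2)[of h] min[of "x - h"] 2 by auto
    qed
    then show ?thesis using d 2 by (simp add: poly_geg mult_nonneg_nonpos)
  next
    case 3
    have "poly (pderiv p) x \<ge> 0"
    proof (rule ccontr)
      assume "\<not> ?thesis"
      then obtain r where r: "r > 0" "\<And>h. 0 < h \<Longrightarrow> h < r \<Longrightarrow> poly p (x + h) < poly p x"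
        using DERIV_neg_dec_right[OF poly_DERIV, of p x] by (auto simp: not_le)
      define h where "h = min (r / 2) 1"
      have "0 < h" "h < r" "h \<le> 1" using r(1) by (auto simp: h_def)
      then show False
        using r(2)[of h] min[of "x + h"] 3 by auto
    qed
    then show ?thesis using d 3 by (simp add: poly_geg mult_nonpos_nonneg)
  qed
qed

text \<open>Maximum principle: at a minimum of \<open>u t x + \<epsilon> * t\<close> over \<open>[0, T] \<times> [-1, 1]\<close> with
  positive time, the time derivative of \<open>u\<close> would be at most \<open>-\<epsilon>\<close>, whereas
  \<open>geg d u \<ge> 0\<close> there.\<close>

lemma heat_pos:
  assumes d: "d \<ge> 2" and e: "\<And>n. geg d (e n) = smult (- geg_ev d n) (e n)"
    and pos: "\<And>x. x \<in> {-1..1} \<Longrightarrow> poly (\<Sum>n\<le>N. e n) x > 0"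
    and t: "t \<ge> 0" and x: "x \<in> {-1..1}"
  shows "poly (heat d N e t) x > 0"
proof (rule ccontr)
  assume neg: "\<not> ?thesis"
  define u where "u = (\<lambda>t. poly (heat d N e t))"
  have u0: "u 0 = poly (\<Sum>n\<le>N. e n)"
    by (auto simp: u_def heat_def fun_eq_iff)
  have tpos: "t > 0" using neg pos[OF x] t u0 by (cases "t = 0") (auto simp: u_def)
  have "\<exists>m\<in>{-1..1::real}. \<forall>y\<in>{-1..1}. u 0 m \<le> u 0 y"
    unfolding u0 by (rule continuous_attains_inf) (auto intro!: continuous_intros)
  then obtain m where m: "m \<in> {-1..1}" "\<And>y. y \<in> {-1..1} \<Longrightarrow> u 0 m \<le> u 0 y" by auto
  have m0: "u 0 m > 0" using pos[OF m(1)] by (simp add: u0)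
  \<comment> \<open>With this tilt the supposed nonpositive value at time \<open>t\<close> is raised
    to at most half of the initial minimum, so the minimum over the cylinder cannot lie on the
    initial slice.\<close>
  define \<epsilon> where "\<epsilon> = u 0 m / (2 * t)"
  have \<epsilon>: "\<epsilon> > 0" using m0 tpos by (simp add: \<epsilon>_def)
  define w where "w = (\<lambda>z. u (fst z) (snd z) + \<epsilon> * fst z)"
  have "\<exists>z\<in>{0..t} \<times> {-1..1}. \<forall>y\<in>{0..t} \<times> {-1..1}. w z \<le> w y"
    by (rule continuous_attains_inf)
       (use t in \<open>auto simp: w_def u_def poly_heat intro!: continuous_intros compact_Times\<close>)
  then obtain s y where sy: "s \<in> {0..t}" "y \<in> {-1..1}"
    and min: "\<And>s' y'. s' \<in> {0..t} \<Longrightarrow> y' \<in> {-1..1} \<Longrightarrow> w (s, y) \<le> w (s', y')"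
    by (metis (no_types, lifting) SigmaE mem_Sigma_iff)
  have wt: "w (t, x) \<le> u 0 m / 2" using neg tpos by (simp add: w_def u_def \<epsilon>_def)
  have s: "s > 0"
  proof (rule ccontr)
    assume "\<not> s > 0"
    then have "s = 0" using sy by auto
    then have "w (s, y) \<ge> u 0 m" using m(2)[OF sy(2)] by (simp add: w_def)
    then show False using min[of t x] wt x t m0 by auto
  qed
  have "poly (geg d (heat d N e s)) y \<ge> 0"
  proof (rule geg_nonneg_at_min[OF d sy(2)])
    fix y' :: real assume "y' \<in> {-1..1}"
    from min[OF sy(1) this] show "poly (heat d N e s) y \<le> poly (heat d N e s) y'"
      by (simp add: w_def u_def)
  qed
  then have pos': "poly (geg d (heat d N e s)) y + \<epsilon> > 0" using \<epsilon> by linarith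
  have "((\<lambda>t. w (t, y)) has_field_derivative poly (geg d (heat d N e s)) y + \<epsilon>) (at s)"
    unfolding w_def u_def by (auto intro!: derivative_eq_intros DERIV_heat[OF e])
  \<comment> \<open>Only earlier times are compared, which also covers a minimum at the final time
    \<open>s = t\<close>.\<close>
  from DERIV_pos_inc_left[OF this pos'] obtain r where
    r: "r > 0" "\<And>h. 0 < h \<Longrightarrow> h < r \<Longrightarrow> w (s - h, y) < w (s, y)" by blast
  define h where "h = min (r / 2) s"
  have "0 < h" "h < r" "h \<le> s" using r(1) s by (auto simp: h_def)
  then show False
    using r(2)[of h] min[of "s - h" y] s sy by auto
qed

section \<open>The spherical Carlen--Lieb--Loss inequality\<close>

lemma integrable_sphere_sigma_continuous:
  fixes D :: "real^'n \<Rightarrow> real"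
  assumes "continuous_on (sphere 0 1) D" "D \<in> borel_measurable borel"
  shows "integrable (sphere_sigma TYPE('n)) D"
proof -
  interpret prob_space "sphere_sigma TYPE('n)" by (rule prob_space_sphere_sigma)
  obtain B where B: "\<And>x. norm x = 1 \<Longrightarrow> \<bar>D x\<bar> \<le> B"
    using compact_imp_bounded[OF compact_continuous_image[OF assms(1) compact_sphere]]
    by (force simp: bounded_iff)
  show ?thesis
  proof (rule integrable_const_bound)
    show "AE x in sphere_sigma TYPE('n). norm (D x) \<le> B"
      using AE_sphere_sigma by eventually_elim (simp add: B)
  qed (use assms(2) in simp)
qed

lemma sphere_component_mem:
  "norm (x :: real^'n) = 1 \<Longrightarrow> x $ k \<in> {-1..1}"
  using component_le_norm_cart[of x k] by auto

lemma DERIV_poly_comp: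
  fixes f :: "real \<Rightarrow> real"
  assumes "(f has_field_derivative D) (at x)"
  shows "((\<lambda>x. poly p (f x)) has_field_derivative poly (pderiv p) (f x) * D) (at x)"
  using DERIV_chain2[OF poly_DERIV assms] .

lemma DERIV_ln_poly:
  fixes f :: "real \<Rightarrow> real"
  assumes "(f has_field_derivative D) (at x)" "poly p (f x) > 0"
  shows "((\<lambda>x. ln (poly p (f x))) has_field_derivative poly (pderiv p) (f x) * D / poly p (f x)) (at x)"
  using DERIV_chain2[OF DERIV_ln_divide[OF assms(2)] DERIV_poly_comp[OF assms(1)]] by simp

text \<open>Going through logarithms makes each derivative the product times a sum over the factors.
  It is the product of the square roots only where all factors are positive.\<close>

definition root_prod :: "('n \<Rightarrow> real poly) \<Rightarrow> real^'n::finite \<Rightarrow> real" where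
  "root_prod p x = exp ((\<Sum>k\<in>UNIV. ln (poly (p k) (x $ k))) / 2)"

lemma borel_measurable_nth [measurable]: "(\<lambda>x. x $ k) \<in> borel_measurable (borel :: (real^'n) measure)"
  by (intro borel_measurable_continuous_onI continuous_intros)

lemma borel_measurable_root_prod [measurable]: "root_prod p \<in> borel_measurable borel"
  unfolding root_prod_def by measurable

section \<open>Infinitesimal rotations and the dissipation inequality\<close>

context
  fixes p :: "'n::finite \<Rightarrow> real poly"
  assumes pos: "\<And>k x. x \<in> {-1..1} \<Longrightarrow> poly (p k) x > 0"
begin

lemma pos_sphere: "norm (x :: real^'n) = 1 \<Longrightarrow> poly (p k) (x $ k) > 0"
  using pos sphere_component_mem by blast

lemma continuous_on_root_prod: "continuous_on (sphere 0 1) (root_prod p)"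
  unfolding root_prod_def
  by (auto intro!: continuous_intros simp: less_imp_neq[OF pos_sphere, symmetric])

text \<open>Let \<open>L\<close> be the infinitesimal rotation \<open>x_k\<close> to
  \<open>x_j\<close>, \<open>x_j\<close> to \<open>- x_k\<close>. Then \<open>slope k j\<close> is
  the logarithmic derivative of the \<open>k\<close>-th factor along \<open>L\<close>, and
  \<open>- slope j k\<close> is that of the \<open>j\<close>-th factor.\<close>

private definition slope :: "'n \<Rightarrow> 'n \<Rightarrow> real^'n \<Rightarrow> real" where
  "slope k j x = x $ j * poly (pderiv (p k)) (x $ k) / poly (p k) (x $ k)"

text \<open>The second derivative of the \<open>k\<close>-th factor along the same rotation, divided
  by the factor; the second term appears because the coefficient \<open>x_j\<close> is rotated
  too.\<close>

private definition curv :: "'n \<Rightarrow> 'n \<Rightarrow> real^'n \<Rightarrow> real" where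
  "curv k j x = ((x $ j)\<^sup>2 * poly (pderiv (pderiv (p k))) (x $ k)
     - x $ k * poly (pderiv (p k)) (x $ k)) / poly (p k) (x $ k)"

private lemma slope_meas [measurable]: "slope k j \<in> borel_measurable borel"
  unfolding slope_def by measurable

private lemma curv_meas [measurable]: "curv k j \<in> borel_measurable borel"
  unfolding curv_def by measurable

private lemma continuous_on_slope: "continuous_on (sphere 0 1) (slope k j)"
  unfolding slope_def
  by (auto intro!: continuous_intros simp: less_imp_neq[OF pos_sphere, symmetric])

private lemma continuous_on_curv: "continuous_on (sphere 0 1) (curv k j)"
  unfolding curv_def
  by (auto intro!: continuous_intros simp: less_imp_neq[OF pos_sphere, symmetric])

text \<open>The derivative of \<open>root_prod p * slope k j\<close> along the rotation in the plane
  \<open>(k, j)\<close>. The division by 2 comes from the square roots, which halve the logarithmic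
  derivatives of the two moving factors.\<close>

private definition flux :: "'n \<Rightarrow> 'n \<Rightarrow> real^'n \<Rightarrow> real" where
  "flux k j x = root_prod p x * (curv k j x - slope k j x * (slope k j x + slope j k x) / 2)"

private lemma flux_meas [measurable]: "flux k j \<in> borel_measurable borel"
  unfolding flux_def by measurable

private lemma continuous_on_flux: "continuous_on (sphere 0 1) (flux k j)"
  unfolding flux_def
  by (intro continuous_intros continuous_on_slope continuous_on_curv continuous_on_root_prod) auto

private lemma DERIV_root_prod:
  assumes kj: "k \<noteq> j" and x: "norm x = 1"
  shows "((\<lambda>\<theta>. root_prod p (plane_rot k j \<theta> x)) has_field_derivative
    root_prod p (plane_rot k j \<theta> x) * ((slope k j (plane_rot k j \<theta> x) - slope j k (plane_rot k j \<theta> x)) / 2)) (at \<theta>)"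
proof -
  define y where "y = plane_rot k j \<theta> x"
  have y: "norm y = 1"
    using x orthogonal_transformation_plane_rot[OF kj, of \<theta>] by (simp add: y_def orthogonal_transformation)
  define c where "c = (\<lambda>l. if l = k then y $ j else if l = j then - (y $ k) else 0)"
  have dl: "((\<lambda>\<theta>. ln (poly (p l) (plane_rot k j \<theta> x $ l))) has_field_derivative
      poly (pderiv (p l)) (y $ l) * c l / poly (p l) (y $ l)) (at \<theta>)" for l
  proof -
    have "((\<lambda>\<theta>. plane_rot k j \<theta> x $ l) has_field_derivative c l) (at \<theta>)"
      using DERIV_plane_rot[OF kj, of x l \<theta>] unfolding c_def y_def .
    moreover have "poly (p l) (plane_rot k j \<theta> x $ l) > 0"
      using pos_sphere[OF y, of l] by (simp add: y_def)
    ultimately show ?thesis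
      unfolding y_def by (rule DERIV_ln_poly)
  qed
  have "(\<Sum>l\<in>UNIV. poly (pderiv (p l)) (y $ l) * c l / poly (p l) (y $ l))
      = (\<Sum>l\<in>UNIV. (if l = k then slope k j y else 0) + (if l = j then - slope j k y else 0))"
    using kj by (intro sum.cong) (auto simp: c_def slope_def)
  also have "\<dots> = slope k j y - slope j k y"
    by (simp add: sum.distrib)
  finally have s: "(\<Sum>l\<in>UNIV. poly (pderiv (p l)) (y $ l) * c l / poly (p l) (y $ l))
      = slope k j y - slope j k y" .
  have "((\<lambda>\<theta>. root_prod p (plane_rot k j \<theta> x)) has_field_derivative
      root_prod p y * ((\<Sum>l\<in>UNIV. poly (pderiv (p l)) (y $ l) * c l / poly (p l) (y $ l)) / 2)) (at \<theta>)"
    unfolding root_prod_def y_def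
    by (rule DERIV_chain2[OF DERIV_exp DERIV_cdivide[OF DERIV_sum[OF dl[unfolded y_def]]]])
  then show ?thesis unfolding s by (simp add: y_def)
qed

private lemma integral_flux:
  assumes kj: "k \<noteq> j"
  shows "(\<integral>x. flux k j x \<partial>sphere_sigma TYPE('n)) = 0"
proof (rule integral_rotation_derivative[OF kj continuous_on_flux, where \<psi>="\<lambda>x. root_prod p x * slope k j x"])
  fix x :: "real^'n" and \<theta> assume x: "norm x = 1"
  define y where "y = plane_rot k j \<theta> x"
  have y: "norm y = 1"
    using x orthogonal_transformation_plane_rot[OF kj, of \<theta>] by (simp add: y_def orthogonal_transformation)
  have q: "poly (p k) (y $ k) \<noteq> 0" using pos_sphere[OF y, of k] by simp
  have dk: "((\<lambda>\<theta>. plane_rot k j \<theta> x $ k) has_field_derivative y $ j) (at \<theta>)"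
    using DERIV_plane_rot[OF kj, of x k \<theta>] by (simp add: y_def)
  have dj: "((\<lambda>\<theta>. plane_rot k j \<theta> x $ j) has_field_derivative - (y $ k)) (at \<theta>)"
    using DERIV_plane_rot[OF kj, of x j \<theta>] kj by (simp add: y_def)
  have "((\<lambda>\<theta>. slope k j (plane_rot k j \<theta> x)) has_field_derivative
      curv k j y - (slope k j y)\<^sup>2) (at \<theta>)"
    unfolding slope_def
    by (rule DERIV_cong[OF DERIV_divide[OF DERIV_mult[OF dj DERIV_poly_comp[OF dk]] DERIV_poly_comp[OF dk]]])
       (use q in \<open>simp_all add: y_def[symmetric] curv_def slope_def divide_simps power2_eq_square algebra_simps\<close>)
  from DERIV_mult[OF DERIV_root_prod[OF kj x] this]
  show "((\<lambda>\<theta>. root_prod p (plane_rot k j \<theta> x) * slope k j (plane_rot k j \<theta> x)) has_field_derivative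
      flux k j (plane_rot k j \<theta> x)) (at \<theta>)"
    by (rule DERIV_cong) (simp add: flux_def y_def[symmetric] field_simps power2_eq_square)
qed measurable

text \<open>The derivatives of the heat flow split into plane rotations, and only the factors
  \<open>k\<close> and \<open>j\<close> depend on the rotation in the plane \<open>(k, j)\<close>. After integration by
  parts, the contribution of that plane is a perfect square.\<close>

lemma dissipation:
  "(\<integral>x. root_prod p x * (\<Sum>k\<in>UNIV. poly (geg CARD('n) (p k)) (x $ k) / poly (p k) (x $ k))
     \<partial>sphere_sigma TYPE('n)) \<ge> 0"
proof -
  let ?S = "sphere_sigma TYPE('n)"
  interpret prob_space ?S by (rule prob_space_sphere_sigma)
  define I where "I = (\<lambda>k. UNIV - {k :: 'n})"
  have flux_int: "(\<integral>x. (\<Sum>k\<in>UNIV. \<Sum>j\<in>I k. flux k j x) \<partial>?S) = 0"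
    using integrable_sphere_sigma_continuous[OF continuous_on_flux flux_meas]
    by (subst Bochner_Integration.integral_sum)
       (auto simp: integral_flux I_def intro!: Bochner_Integration.integral_sum[THEN trans] sum.neutral)
  \<comment> \<open>The planes through axis \<open>k\<close> together give the full operator: the
    squares of the other coordinates sum to \<open>1 - (x $ k)\<^sup>2\<close> on the sphere, and
    there are \<open>CARD('n) - 1\<close> such planes.\<close>
  have curv_sum: "(\<Sum>j\<in>I k. curv k j x) = poly (geg CARD('n) (p k)) (x $ k) / poly (p k) (x $ k)"
    if x: "norm x = 1" for x k
  proof -
    have "(\<Sum>j\<in>UNIV. (x $ j)\<^sup>2) = 1"
      using x by (simp add: norm_vec_def L2_set_def)
    then have "(\<Sum>j\<in>I k. (x $ j)\<^sup>2) = 1 - (x $ k)\<^sup>2"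
      by (simp add: I_def sum_diff1)
    moreover have "real (card (I k)) = real CARD('n) - 1"
      by (simp add: I_def card_Diff_singleton of_nat_diff)
    ultimately show ?thesis
      unfolding curv_def sum_divide_distrib[symmetric] sum_subtractf sum_distrib_right[symmetric]
      by (simp add: poly_geg mult_ac)
  qed
  have ineq: "(\<Sum>k\<in>UNIV. \<Sum>j\<in>I k. flux k j x)
      \<le> root_prod p x * (\<Sum>k\<in>UNIV. poly (geg CARD('n) (p k)) (x $ k) / poly (p k) (x $ k))"
    if x: "norm x = 1" for x
  proof -
    \<comment> \<open>A single \<open>c k j\<close> has no sign. Adding the two orders of a plane
      gives \<open>(slope k j x + slope j k x)\<^sup>2\<close>.\<close>
    define c where "c = (\<lambda>k j. if j \<in> I k then slope k j x * (slope k j x + slope j k x) else 0)"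
    have "(\<Sum>k\<in>UNIV. \<Sum>j\<in>UNIV. c k j) = (\<Sum>k\<in>UNIV. \<Sum>j\<in>UNIV. c j k)"
      by (rule sum.swap)
    then have "2 * (\<Sum>k\<in>UNIV. \<Sum>j\<in>UNIV. c k j) = (\<Sum>k\<in>UNIV. \<Sum>j\<in>UNIV. c k j + c j k)"
      by (simp add: sum.distrib)
    also have "\<dots> \<ge> 0"
    proof (intro sum_nonneg)
      fix k j
      have "c k j + c j k = (if j \<in> I k then (slope k j x + slope j k x)\<^sup>2 else 0)"
        by (auto simp: c_def I_def power2_eq_square algebra_simps)
      then show "c k j + c j k \<ge> 0" by simp
    qed
    finally have c: "(\<Sum>k\<in>UNIV. \<Sum>j\<in>UNIV. c k j) \<ge> 0" by simp
    have c2: "(\<Sum>j\<in>UNIV. c k j) = (\<Sum>j\<in>I k. slope k j x * (slope k j x + slope j k x))" for k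
      unfolding c_def by (subst sum.inter_restrict[symmetric]) auto
    have "(\<Sum>k\<in>UNIV. \<Sum>j\<in>I k. flux k j x) = root_prod p x *
       ((\<Sum>k\<in>UNIV. \<Sum>j\<in>I k. curv k j x) - (\<Sum>k\<in>UNIV. \<Sum>j\<in>UNIV. c k j) / 2)"
      unfolding c2 flux_def sum_distrib_left[symmetric] sum_subtractf sum_divide_distrib[symmetric] ..
    also have "\<dots> \<le> root_prod p x * (\<Sum>k\<in>UNIV. \<Sum>j\<in>I k. curv k j x)"
      using c by (intro mult_left_mono) (auto simp: root_prod_def)
    finally show ?thesis by (simp add: curv_sum[OF x])
  qed
  have "(\<integral>x. (\<Sum>k\<in>UNIV. \<Sum>j\<in>I k. flux k j x) \<partial>?S)
     \<le> (\<integral>x. root_prod p x * (\<Sum>k\<in>UNIV. poly (geg CARD('n) (p k)) (x $ k) / poly (p k) (x $ k)) \<partial>?S)"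
  proof (rule integral_mono_AE)
    show "integrable ?S (\<lambda>x. \<Sum>k\<in>UNIV. \<Sum>j\<in>I k. flux k j x)"
      by (intro Bochner_Integration.integrable_sum integrable_sphere_sigma_continuous[OF continuous_on_flux flux_meas])
    show "integrable ?S (\<lambda>x. root_prod p x * (\<Sum>k\<in>UNIV. poly (geg CARD('n) (p k)) (x $ k) / poly (p k) (x $ k)))"
    proof (rule integrable_sphere_sigma_continuous)
      show "continuous_on (sphere 0 1) (\<lambda>x. root_prod p x * (\<Sum>k\<in>UNIV. poly (geg CARD('n) (p k)) (x $ k) / poly (p k) (x $ k)))"
        by (intro continuous_intros continuous_on_root_prod)
           (auto simp: less_imp_neq[OF pos_sphere, symmetric])
    qed measurable
    show "AE x in ?S. (\<Sum>k\<in>UNIV. \<Sum>j\<in>I k. flux k j x)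
        \<le> root_prod p x * (\<Sum>k\<in>UNIV. poly (geg CARD('n) (p k)) (x $ k) / poly (p k) (x $ k))"
      using AE_sphere_sigma by eventually_elim (rule ineq)
  qed
  then show ?thesis by (simp add: flux_int)
qed

end

section \<open>Monotonicity along the heat flow\<close>

lemma root_prod_eq:
  assumes "\<And>k. poly (p k) (x $ k) > 0"
  shows "root_prod p x = (\<Prod>k\<in>UNIV. sqrt (poly (p k) (x $ k)))"
proof -
  have exp_half: "exp (ln y / 2) = sqrt y" if "y > 0" for y :: real
    using ln_sqrt[of y] that by (metis exp_ln less_imp_le real_sqrt_gt_zero)
  have "root_prod p x = (\<Prod>k\<in>UNIV. exp (ln (poly (p k) (x $ k)) / 2))"
    by (simp add: root_prod_def sum_divide_distrib exp_sum)
  also have "\<dots> = (\<Prod>k\<in>UNIV. sqrt (poly (p k) (x $ k)))"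
    using assms by (intro prod.cong refl) (simp add: exp_half)
  finally show ?thesis .
qed

text \<open>The time derivative of the mean is half of the integral in \<open>dissipation\<close>;
  \<open>heat_pos\<close> keeps the factors in the positive range where that estimate
  applies.\<close>

lemma root_prod_heat_mono:
  fixes e :: "'n::finite \<Rightarrow> nat \<Rightarrow> real poly"
  assumes d: "CARD('n) \<ge> 2"
    and e: "\<And>k n. geg CARD('n) (e k n) = smult (- geg_ev CARD('n) n) (e k n)"
    and pos: "\<And>k x. x \<in> {-1..1} \<Longrightarrow> poly (\<Sum>n\<le>N. e k n) x > 0"
    and T: "T \<ge> 0"
  shows "(\<integral>x. root_prod (\<lambda>k. \<Sum>n\<le>N. e k n) x \<partial>sphere_sigma TYPE('n))
    \<le> (\<integral>x. root_prod (\<lambda>k. heat CARD('n) N (e k) T) x \<partial>sphere_sigma TYPE('n))"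
proof -
  let ?S = "sphere_sigma TYPE('n)"
  interpret prob_space ?S by (rule prob_space_sphere_sigma)
  define h where "h = (\<lambda>t k. heat CARD('n) N (e k) t)"
  have h0: "h 0 = (\<lambda>k. \<Sum>n\<le>N. e k n)"
    by (simp add: h_def heat_def)
  have hpos: "poly (h t k) x > 0" if "t \<ge> 0" "x \<in> {-1..1}" for t k x
    unfolding h_def by (rule heat_pos[OF d e pos]) (use that in auto)
  have hpos': "poly (h t k) (x $ k) > 0" if "t \<ge> 0" "norm x = 1" for t k and x :: "real^'n"
    using hpos that sphere_component_mem by blast
  define g where "g = (\<lambda>t. root_prod (h t))"
  define D where "D = (\<lambda>t x. g t x * ((\<Sum>k\<in>UNIV. poly (geg CARD('n) (h t k)) (x $ k) / poly (h t k) (x $ k)) / 2))"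
  have meas[measurable]: "g t \<in> borel_measurable borel" "D t \<in> borel_measurable borel" for t
    unfolding g_def D_def by measurable
  have c1: "continuous_on ({0..T} \<times> sphere 0 1) (\<lambda>z. poly (h (fst z) k) (snd z $ k))" for k
    unfolding h_def poly_heat by (intro continuous_intros)
  have c2: "continuous_on ({0..T} \<times> sphere 0 1) (\<lambda>z. poly (geg CARD('n) (h (fst z) k)) (snd z $ k))" for k
    unfolding h_def poly_geg_heat[OF e] by (intro continuous_intros)
  have ne: "poly (h (fst z) k) (snd z $ k) \<noteq> 0" if "z \<in> {0..T} \<times> sphere 0 1" for z k
    using hpos'[of "fst z" "snd z" k] that by auto
  have "(\<integral>x. g T x - g 0 x \<partial>?S) = (\<integral>t. indicator {0..T} t * (\<integral>x. D t x \<partial>?S) \<partial>lborel)"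
  proof (rule integral_FTC_param[where K="sphere 0 1"])
    show "finite_measure ?S" by unfold_locales
    show "AE x in ?S. x \<in> sphere 0 1" using AE_sphere_sigma by simp
    show "continuous_on ({0..T} \<times> sphere 0 1) (\<lambda>z. D (fst z) (snd z))"
      unfolding D_def g_def root_prod_def
      by (intro continuous_intros c1 c2 ballI ne) (auto dest: ne)
    fix x :: "real^'n" and t :: real assume x: "x \<in> sphere 0 1" and t: "0 \<le> t"
    have ln: "((\<lambda>t. ln (poly (h t k) (x $ k))) has_field_derivative
        poly (geg CARD('n) (h t k)) (x $ k) / poly (h t k) (x $ k)) (at t)" for k
      using hpos'[of t x k] x t DERIV_heat[where e="e k" and d="CARD('n)" and N=N and x="x $ k" and t=t] e
      by (auto simp: h_def intro!: derivative_eq_intros)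
    show "((\<lambda>t. g t x) has_field_derivative D t x) (at t)"
      unfolding g_def D_def root_prod_def
      by (rule DERIV_chain2[OF DERIV_exp DERIV_cdivide[OF DERIV_sum[OF ln]]])
  qed (use T in auto)
  also have "\<dots> \<ge> 0"
  proof (rule Bochner_Integration.integral_nonneg)
    fix t
    have "(\<integral>x. D t x \<partial>?S) = (\<integral>x. g t x * (\<Sum>k\<in>UNIV. poly (geg CARD('n) (h t k)) (x $ k) / poly (h t k) (x $ k)) \<partial>?S) / 2"
      by (simp add: D_def)
    moreover have "\<dots> \<ge> 0" if "t \<ge> 0"
      unfolding g_def using dissipation[of "h t"] hpos[OF that] by simp
    ultimately show "0 \<le> indicator {0..T} t * (\<integral>x. D t x \<partial>?S)"
      by (auto simp: indicator_def)
  qed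
  finally have "(\<integral>x. g T x - g 0 x \<partial>?S) \<ge> 0" .
  moreover have "integrable ?S (g t)" if "t \<ge> 0" for t
    unfolding g_def
    by (rule integrable_sphere_sigma_continuous[OF continuous_on_root_prod]) (use hpos that in auto)
  ultimately have "(\<integral>x. g 0 x \<partial>?S) \<le> (\<integral>x. g T x \<partial>?S)"
    using T by simp
  then show ?thesis
    unfolding g_def h0 by (simp add: h_def)
qed

section \<open>The measure on the interval: total mass and invariance under the flow\<close>

lemma
  fixes d :: nat
  assumes d: "d \<ge> 2"
  shows prob_space_nu_meas: "prob_space (nu_meas d)"
    and integral_nu_geg: "(\<integral>t. poly (geg d p) t \<partial>nu_meas d) = 0"
proof -
  \<comment> \<open>Everything rests on \<open>(1 - t\<^sup>2) powr a\<close> times a polynomial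
    vanishing at both endpoints. For the polynomial \<open>pderiv p\<close> this is the divergence
    form of \<open>geg d p\<close>, because \<open>2 * a = d - 1\<close>. For the identity it
    computes the mass: the weight \<open>w\<close> has the negative exponent -1/2 when
    \<open>d = 2\<close>, whereas the exponent one higher is an integral known from ball
    volumes.\<close>
  define a where "a = (real d - 1) / 2"
  have a: "a > 0" using d by (simp add: a_def)
  define w where "w = (\<lambda>t::real. (1 - t\<^sup>2) powr (a - 1))"
  have w[measurable]: "w \<in> borel_measurable borel" unfolding w_def by measurable
  have w0: "w t \<ge> 0" for t by (simp add: w_def)
  have pos: "1 - t\<^sup>2 > 0" if "-1 < t" "t < 1" for t :: real
    using that by (simp add: abs_square_less_1)
  have split: "(1 - t\<^sup>2) powr a = (1 - t\<^sup>2) * w t" if "-1 < t" "t < 1" for t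
    using pos[OF that] by (simp add: w_def powr_diff)
  have cont: "continuous_on {-1..1} (\<lambda>t::real. (1 - t\<^sup>2) powr a)"
    using a by (intro continuous_on_powr' continuous_intros) (auto simp: abs_square_le_1)
  text \<open>\<open>d/dt ((1 - t\<^sup>2) powr a * f t) = w t * ((1 - t\<^sup>2) * f' t - 2 * a * t * f t)\<close>\<close>
  have FTC: "((\<lambda>t. w t * ((1 - t\<^sup>2) * poly (pderiv q) t - 2 * a * t * poly q t)) has_integral 0) {-1..1}" for q
  proof -
    have "((\<lambda>t. w t * ((1 - t\<^sup>2) * poly (pderiv q) t - 2 * a * t * poly q t)) has_integral
      ((1 - 1\<^sup>2) powr a * poly q 1 - (1 - (-1)\<^sup>2) powr a * poly q (-1))) {-1..1}"
    proof (rule fundamental_theorem_of_calculus_interior)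
      show "continuous_on {-1..1} (\<lambda>t. (1 - t\<^sup>2) powr a * poly q t)"
        by (intro continuous_intros cont)
      fix t :: real assume "t \<in> {-1<..<1}"
      then have t: "-1 < t" "t < 1" by auto
      have "((\<lambda>t. (1 - t\<^sup>2) powr a) has_field_derivative a * (1 - t\<^sup>2) powr (a - 1) * (- 2 * t)) (at t)"
        using pos[OF t] by (auto intro!: derivative_eq_intros)
      from DERIV_mult[OF this poly_DERIV[of q t]]
      show "((\<lambda>t. (1 - t\<^sup>2) powr a * poly q t) has_vector_derivative
          w t * ((1 - t\<^sup>2) * poly (pderiv q) t - 2 * a * t * poly q t)) (at t)"
        unfolding has_real_derivative_iff_has_vector_derivative[symmetric]
        by (rule DERIV_cong) (simp add: split[OF t] w_def algebra_simps)
    qed simp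
    then show ?thesis by simp
  qed
  define b where "b = Beta (1/2) (a + 1)"
  have "(\<integral>\<^sup>+ x. ennreal ((1 - x\<^sup>2) powr a * indicator {-1..1} x) \<partial>lborel) = ennreal b"
  proof -
    have "(\<integral>\<^sup>+ x. ennreal ((1 - x\<^sup>2) powr a * indicator {-1..1} x) \<partial>lborel)
      = (\<integral>\<^sup>+x. ennreal (indicator {-1..1} x * sqrt (1 - x\<^sup>2) ^ (d - 1)) \<partial>lborel)"
    proof (rule nn_integral_cong_AE)
      have "AE x in lborel. x \<noteq> (1::real)" "AE x in lborel. x \<noteq> (-1::real)"
        by (rule AE_lborel_singleton)+
      then show "AE x in lborel. ennreal ((1 - x\<^sup>2) powr a * indicator {-1..1} x)
          = ennreal (indicator {-1..1} x * sqrt (1 - x\<^sup>2) ^ (d - 1))"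
      proof eventually_elim
        case (elim x)
        show ?case
        proof (cases "x \<in> {-1..1}")
          case True
          then have "1 - x\<^sup>2 > 0" using elim pos[of x] by auto
          then have "sqrt (1 - x\<^sup>2) ^ (d - 1) = (1 - x\<^sup>2) powr a"
            using d by (simp add: powr_half_sqrt[symmetric] powr_powr a_def flip: powr_realpow)
          then show ?thesis by simp
        qed simp
      qed
    qed
    also have "\<dots> = ennreal b"
      using emeasure_cball_aux_integral[of "d - 1"] d by (simp add: b_def a_def)
    finally show ?thesis .
  qed
  then have "((\<lambda>x. (1 - x\<^sup>2) powr a * indicator {-1..1} x) has_integral b) UNIV"
    by (intro nn_integral_has_integral) (use a in \<open>auto simp: b_def Beta_def Gamma_real_pos\<close>)
  moreover have "(\<lambda>x. (1 - x\<^sup>2) powr a * indicator {-1..1} x)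
      = (\<lambda>x. if x \<in> {-1..1} then (1 - x\<^sup>2) powr a else 0)"
    by (auto simp: indicator_def)
  ultimately have intb: "((\<lambda>x. (1 - x\<^sup>2) powr a) has_integral b) {-1..1}"
    using has_integral_restrict_UNIV[of "{-1..1}" "\<lambda>x. (1 - x\<^sup>2) powr a" b] by (simp only:)
  define c where "c = sphere_area (d - 1) / sphere_area d"
  have c: "c = Gamma (a + 1/2) / (sqrt pi * Gamma a)"
  proof -
    have "real (d - 1) / 2 = a" "real d / 2 = a + 1/2" using d by (auto simp: a_def of_nat_diff field_simps)
    then show ?thesis
      unfolding c_def sphere_area_def by (simp only:) (simp add: powr_add powr_half_sqrt)
  qed
  have G: "Gamma a > 0" "Gamma (a + 1/2) > 0" using a by (auto simp: Gamma_real_pos)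
  have c0: "c \<ge> 0" using G by (simp add: c)
  have cb: "c * ((2 * a + 1) / (2 * a) * b) = 1"
  proof -
    have "Gamma (a + 1) = a * Gamma a" "Gamma (1/2 + (a + 1)) = (a + 1/2) * Gamma (a + 1/2)"
      using Gamma_plus1[of a] Gamma_plus1[of "a + 1/2"] a
      by (auto simp: nonpos_Ints_def add_ac dest!: sym[of _ "of_int _"])
    then have "c * ((2 * a + 1) / (2 * a) * b) = Gamma (a + 1/2) / (sqrt pi * Gamma a) *
        ((2 * a + 1) / (2 * a) * (sqrt pi * (a * Gamma a) / ((2 * a + 1) / 2 * Gamma (a + 1/2))))"
      by (simp add: c b_def Beta_def Gamma_one_half_real add_divide_distrib)
    also have "\<dots> = 1"
    proof -
      have cancel: "B / (s * A) * (k / (2 * a) * (s * (a * A) / (k / 2 * B))) = 1"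
        if "A > 0" "B > 0" "s > 0" "k > 0" for A B s k :: real
        using that a by simp
      show ?thesis by (rule cancel) (use G a in auto)
    qed
    finally show ?thesis .
  qed
  \<comment> \<open>Use \<open>FTC\<close> with the identity polynomial and write
    \<open>t\<^sup>2 = 1 - (1 - t\<^sup>2)\<close>: this expresses \<open>2 * a\<close> times the
    mass of \<open>w\<close> as \<open>2 * a + 1\<close> times \<open>b\<close>.\<close>
  have wint: "(w has_integral ((2 * a + 1) / (2 * a) * b)) {-1..1}"
  proof -
    have "((\<lambda>t. (2 * a + 1) / (2 * a) * (1 - t\<^sup>2) powr a - 1 / (2 * a) *
        (w t * ((1 - t\<^sup>2) * poly (pderiv [:0, 1:]) t - 2 * a * t * poly [:0, 1:] t)))
      has_integral (2 * a + 1) / (2 * a) * b - 1 / (2 * a) * 0) {-1..1}"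
      by (intro has_integral_diff has_integral_mult_right intb FTC)
    moreover have "w t = (2 * a + 1) / (2 * a) * (1 - t\<^sup>2) powr a - 1 / (2 * a) *
        (w t * ((1 - t\<^sup>2) * poly (pderiv [:0, 1:]) t - 2 * a * t * poly [:0, 1:] t))" if "t \<in> {-1..1} - {-1,1}" for t
    proof -
      have "-1 < t" "t < 1" using that by auto
      then show ?thesis
        unfolding split[OF \<open>-1 < t\<close> \<open>t < 1\<close>] using a by (simp add: pderiv_pCons field_simps power2_eq_square)
    qed
    ultimately have "(w has_integral (2 * a + 1) / (2 * a) * b - 1 / (2 * a) * 0) {-1..1}"
      by (intro has_integral_spike_finite[of "{-1,1}" "{-1..1}" w]) auto
    then show ?thesis by simp
  qed
  have wnn: "(\<integral>\<^sup>+ t. ennreal (indicator {-1..1} t * w t) \<partial>lborel) = ennreal ((2 * a + 1) / (2 * a) * b)"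
    using nn_integral_has_integral_lebesgue[OF _ wint] w0 by simp
  have nu: "nu_meas d = density lborel (\<lambda>t. ennreal (c * (indicator {-1<..<1} t * w t)))"
    unfolding nu_meas_def
  proof (rule arg_cong[where f="density lborel"], rule ext)
    fix t
    have eq: "(real d - 3) / 2 = a - 1" by (simp add: a_def field_simps)
    show "indicator {-1<..<1} t * ennreal (sphere_area (d - 1) / sphere_area d * (1 - t\<^sup>2) powr ((real d - 3) / 2))
        = ennreal (c * (indicator {-1<..<1} t * w t))"
      unfolding eq by (auto simp: c_def w_def indicator_def)
  qed
  have ends: "AE t in lborel. t \<noteq> (1::real) \<and> t \<noteq> -1"
    using AE_lborel_singleton[of "1::real"] AE_lborel_singleton[of "-1::real"] by eventually_elim simp
  show prob: "prob_space (nu_meas d)"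
  proof (rule prob_spaceI)
    have "emeasure (nu_meas d) (space (nu_meas d))
        = (\<integral>\<^sup>+ t. ennreal (c * (indicator {-1<..<1} t * w t)) \<partial>lborel)"
      unfolding nu by (subst emeasure_density) (auto intro!: nn_integral_cong)
    also have "\<dots> = (\<integral>\<^sup>+ t. ennreal c * ennreal (indicator {-1..1} t * w t) \<partial>lborel)"
      using ends by (intro nn_integral_cong_AE, eventually_elim)
        (auto simp: indicator_def ennreal_mult' c0)
    also have "\<dots> = ennreal c * ennreal ((2 * a + 1) / (2 * a) * b)"
      by (simp add: nn_integral_cmult wnn)
    also have "\<dots> = 1"
      using cb c0 by (simp add: ennreal_mult'[symmetric])
    finally show "emeasure (nu_meas d) (space (nu_meas d)) = 1" .
  qed
  show "(\<integral>t. poly (geg d p) t \<partial>nu_meas d) = 0"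
  proof -
    let ?f = "\<lambda>t. (c * (indicator {-1<..<1} t * w t)) * poly (geg d p) t"
    obtain B where B: "\<And>t. t \<in> {-1..1} \<Longrightarrow> \<bar>poly (geg d p) t\<bar> \<le> B"
      using compact_imp_bounded[OF compact_continuous_image[of "{-1..1}" "poly (geg d p)"]]
      by (force simp: bounded_iff intro: continuous_intros)
    have "integrable (nu_meas d) (poly (geg d p))"
    proof -
      interpret prob_space "nu_meas d" by (rule prob)
      show ?thesis
      proof (rule integrable_const_bound)
        show "AE t in nu_meas d. norm (poly (geg d p) t) \<le> B"
          unfolding nu by (subst AE_density) (auto intro!: AE_I2 B simp: indicator_def split: if_splits)
      qed (simp add: nu)
    qed
    then have int: "integrable lborel ?f"
      unfolding nu by (subst (asm) integrable_real_density) (auto simp: c0 w0)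
    have "(?f has_integral 0) UNIV"
    proof -
      have "((\<lambda>t. c * (w t * ((1 - t\<^sup>2) * poly (pderiv (pderiv p)) t - 2 * a * t * poly (pderiv p) t)))
          has_integral c * 0) {-1..1}"
        by (intro has_integral_mult_right FTC)
      moreover have "w t * ((1 - t\<^sup>2) * poly (pderiv (pderiv p)) t - 2 * a * t * poly (pderiv p) t)
          = w t * poly (geg d p) t" for t
        by (simp add: poly_geg a_def)
      ultimately have "((\<lambda>t. c * (w t * poly (geg d p) t)) has_integral 0) {-1..1}" by simp
      then have "((\<lambda>t. if t \<in> {-1..1} then c * (w t * poly (geg d p) t) else 0) has_integral 0) UNIV"
        by (simp only: has_integral_restrict_UNIV)
      then show ?thesis
        by (rule has_integral_spike_finite[of "{-1,1}", rotated 2]) (auto simp: indicator_def)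
    qed
    then have "integral\<^sup>L lborel ?f = 0"
      using has_integral_integral_lborel[OF int] has_integral_unique by blast
    then show ?thesis
      unfolding nu by (subst integral_real_density) (auto simp: c0 w0)
  qed
qed

section \<open>Mean values, decay of the flow and the polynomial case\<close>

lemma integrable_nu_poly:
  assumes "d \<ge> 2"
  shows "integrable (nu_meas d) (poly p)"
    and AE_nu_meas: "AE t in nu_meas d. t \<in> {-1..1}"
proof -
  show ae: "AE t in nu_meas d. t \<in> {-1..1}"
    unfolding nu_meas_def by (subst AE_density) (auto intro!: AE_I2 simp: indicator_def split: if_splits)
  interpret prob_space "nu_meas d" by (rule prob_space_nu_meas[OF assms])
  obtain B where B: "\<And>t. t \<in> {-1..1} \<Longrightarrow> \<bar>poly p t\<bar> \<le> B"
    using compact_imp_bounded[OF compact_continuous_image[of "{-1..1}" "poly p"]]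
    by (force simp: bounded_iff intro: continuous_intros)
  show "integrable (nu_meas d) (poly p)"
  proof (rule integrable_const_bound)
    show "AE t in nu_meas d. norm (poly p t) \<le> B"
      using ae by eventually_elim (simp add: B)
  qed (simp add: nu_meas_def)
qed

lemma sets_nu_meas [measurable_cong, simp]: "sets (nu_meas d) = sets borel"
  by (simp add: nu_meas_def)

lemma space_nu_meas [simp]: "space (nu_meas d) = UNIV"
  by (simp add: nu_meas_def)

text \<open>Since \<open>geg\<close> has mean zero, an eigenfunction with nonzero eigenvalue has
  mean zero. This identifies the constant mode, to which the flow converges, with the mean of the
  initial datum.\<close>

lemma integral_nu_eigen:
  assumes d: "d \<ge> 2" and e: "\<And>n. geg d (e n) = smult (- geg_ev d n) (e n)" "degree (e 0) = 0"
  shows "(\<integral>t. poly (\<Sum>n\<le>N. e n) t \<partial>nu_meas d) = coeff (e 0) 0"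
proof -
  interpret prob_space "nu_meas d" by (rule prob_space_nu_meas[OF d])
  have n: "(\<integral>t. poly (e n) t \<partial>nu_meas d) = (if n = 0 then coeff (e 0) 0 else 0)" for n
  proof (cases "n = 0")
    case True
    have "e 0 = [:coeff (e 0) 0:]" using e(2) by (metis degree_0_id)
    then have "poly (e 0) = (\<lambda>t. coeff (e 0) 0)" by (metis mult_zero_right poly_0 poly_pCons add_0_right ext)
    then show ?thesis using True prob_space by simp
  next
    case False
    have "(\<integral>t. poly (geg d (e n)) t \<partial>nu_meas d) = - geg_ev d n * (\<integral>t. poly (e n) t \<partial>nu_meas d)"
      by (simp add: e(1))
    then show ?thesis
      using integral_nu_geg[OF d, of "e n"] geg_ev_pos[OF d, of n] False by simp
  qed
  show ?thesis
    by (simp add: poly_sum Bochner_Integration.integral_sum integrable_nu_poly[OF d] n)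
qed

text \<open>For \<open>d \<ge> 2\<close> every nonconstant mode has eigenvalue at least 1, which
  gives one decay rate for all of them, uniformly on the interval.\<close>

lemma heat_upper_bound:
  assumes d: "d \<ge> 2" and e0: "degree (e 0) = 0"
  obtains B where "B \<ge> 0" "\<And>t x. t \<ge> 0 \<Longrightarrow> x \<in> {-1..1} \<Longrightarrow>
    poly (heat d N e t) x \<le> coeff (e 0) 0 + B * exp (- t)"
proof -
  have "\<exists>B. \<forall>x\<in>{-1..1}. \<bar>poly (e n) x\<bar> \<le> B" for n
    using compact_imp_bounded[OF compact_continuous_image[of "{-1..1}" "poly (e n)"]]
    by (force simp: bounded_iff intro: continuous_intros)
  then obtain b where b: "\<And>n x. x \<in> {-1..1} \<Longrightarrow> \<bar>poly (e n) x\<bar> \<le> b n" by metis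
  have b0: "b n \<ge> 0" for n using b[of 0 n] by auto
  have p0: "poly (e 0) x = coeff (e 0) 0" for x
    using e0 by (metis degree_0_id mult_zero_right poly_0 poly_pCons add_0_right)
  show ?thesis
  proof (rule that[of "\<Sum>n=1..N. b n"])
    show "0 \<le> (\<Sum>n=1..N. b n)" by (intro sum_nonneg b0)
    fix t x :: real assume t: "t \<ge> 0" and x: "x \<in> {-1..1}"
    have "{..N} = insert 0 {1..N}" by auto
    then have "poly (heat d N e t) x = coeff (e 0) 0 + (\<Sum>n=1..N. exp (- geg_ev d n * t) * poly (e n) x)"
      by (simp add: poly_heat p0 geg_ev_def)
    also have "(\<Sum>n=1..N. exp (- geg_ev d n * t) * poly (e n) x) \<le> (\<Sum>n=1..N. b n * exp (- t))"
    proof (rule sum_mono)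
      fix n assume n: "n \<in> {1..N}"
      have "1 * 1 \<le> geg_ev d n"
        unfolding geg_ev_def using n d by (intro mult_mono) auto
      then have ex: "exp (- geg_ev d n * t) \<le> exp (- t)"
        using t by (simp add: mult_right_mono[of 1 "geg_ev d n" t, simplified])
      have "exp (- geg_ev d n * t) * poly (e n) x \<le> exp (- geg_ev d n * t) * b n"
        using b[OF x, of n] by (intro mult_left_mono) auto
      also have "\<dots> \<le> exp (- t) * b n"
        by (intro mult_right_mono ex b0)
      finally show "exp (- geg_ev d n * t) * poly (e n) x \<le> b n * exp (- t)" by (simp add: mult.commute)
    qed
    finally show "poly (heat d N e t) x \<le> coeff (e 0) 0 + (\<Sum>n=1..N. b n) * exp (- t)"
      by (simp add: sum_distrib_right)
  qed
qed

lemma spherical_Brascamp_Lieb_poly: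
  fixes p :: "'n::finite \<Rightarrow> real poly"
  assumes d: "CARD('n) \<ge> 2"
    and pos: "\<And>k x. x \<in> {-1..1} \<Longrightarrow> poly (p k) x > 0"
  shows "(\<integral>x. root_prod p x \<partial>sphere_sigma TYPE('n))
    \<le> (\<Prod>k\<in>UNIV. sqrt (\<integral>t. poly (p k) t \<partial>nu_meas CARD('n)))"
proof -
  let ?S = "sphere_sigma TYPE('n)" and ?d = "CARD('n)"
  interpret prob_space ?S by (rule prob_space_sphere_sigma)
  define N where "N = Max (range (\<lambda>k. degree (p k)))"
  have "\<exists>e. (\<forall>n. geg ?d (e n) = smult (- geg_ev ?d n) (e n)) \<and> degree (e 0) = 0 \<and> p k = (\<Sum>n\<le>N. e n)" for k
    by (rule geg_eigen_decomp[OF d]) (simp add: N_def)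
  then obtain e where e: "\<And>k n. geg ?d (e k n) = smult (- geg_ev ?d n) (e k n)"
      "\<And>k. degree (e k 0) = 0" "\<And>k. p k = (\<Sum>n\<le>N. e k n)"
    by metis
  define c where "c = (\<lambda>k. coeff (e k 0) 0)"
  have c: "(\<integral>t. poly (p k) t \<partial>nu_meas ?d) = c k" for k
    unfolding e(3) c_def by (rule integral_nu_eigen[where e="e k", OF d e(1,2)])
  have "\<exists>B\<ge>0. \<forall>t x. t \<ge> 0 \<longrightarrow> x \<in> {-1..1} \<longrightarrow> poly (heat ?d N (e k) t) x \<le> c k + B * exp (- t)" for k
    using heat_upper_bound[where e="e k" and N=N, OF d e(2)] unfolding c_def by metis
  then obtain B where B: "\<And>k t x. t \<ge> 0 \<Longrightarrow> x \<in> {-1..1} \<Longrightarrow> poly (heat ?d N (e k) t) x \<le> c k + B k * exp (- t)"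
    by metis
  have hp: "poly (heat ?d N (e k) t) x > 0" if "t \<ge> 0" "x \<in> {-1..1}" for k t x
    by (rule heat_pos[where e="e k", OF d e(1)]) (use pos that in \<open>auto simp: e(3)[symmetric]\<close>)
  \<comment> \<open>An upper bound for the evolved factors suffices, so the limit in time is taken
    in a finite product of numbers and not under the integral.\<close>
  have bound: "(\<integral>x. root_prod p x \<partial>?S) \<le> (\<Prod>k\<in>UNIV. sqrt (c k + B k * exp (- T)))" if T: "T \<ge> 0" for T
  proof -
    have "(\<integral>x. root_prod p x \<partial>?S) \<le> (\<integral>x. root_prod (\<lambda>k. heat ?d N (e k) T) x \<partial>?S)"
      using root_prod_heat_mono[where e=e and N=N, OF d e(1) _ T] pos by (simp add: e(3)[symmetric])
    also have "\<dots> \<le> (\<Prod>k\<in>UNIV. sqrt (c k + B k * exp (- T)))"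
    proof (rule integral_le_const)
      show "integrable ?S (root_prod (\<lambda>k. heat ?d N (e k) T))"
        by (rule integrable_sphere_sigma_continuous[OF continuous_on_root_prod]) (use hp T in auto)
      show "AE x in ?S. root_prod (\<lambda>k. heat ?d N (e k) T) x \<le> (\<Prod>k\<in>UNIV. sqrt (c k + B k * exp (- T)))"
        using AE_sphere_sigma
      proof eventually_elim
        case (elim x)
        then have "x $ k \<in> {-1..1}" for k by (rule sphere_component_mem)
        then show ?case
          using hp[OF T] B[OF T]
          by (subst root_prod_eq) (auto intro!: prod_mono simp: less_imp_le)
      qed
    qed
    finally show ?thesis .
  qed
  have "((\<lambda>T. \<Prod>k\<in>UNIV. sqrt (c k + B k * exp (- T))) \<longlongrightarrow> (\<Prod>k\<in>UNIV. sqrt (c k + B k * 0))) at_top"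
    by (intro tendsto_intros filterlim_compose[OF exp_at_bot] filterlim_uminus_at_bot_at_top)
  from tendsto_lowerbound[OF this, of "\<integral>x. root_prod p x \<partial>?S"] bound
  show ?thesis by (simp add: c eventually_at_top_linorder exI[of _ 0])
qed

section \<open>From polynomials to measurable functions\<close>

lemma spherical_Brascamp_Lieb_continuous:
  fixes h :: "'n::finite \<Rightarrow> real \<Rightarrow> real"
  assumes d: "CARD('n) \<ge> 2" and cont: "\<And>k. continuous_on UNIV (h k)"
    and h0: "\<And>k t. h k t \<ge> 0"
    and h1: "\<And>k. (\<integral>\<^sup>+ t. ennreal (h k t) \<partial>nu_meas CARD('n)) \<le> 1"
  shows "(\<integral>\<^sup>+ x. ennreal (\<Prod>k\<in>UNIV. sqrt (h k (x $ k))) \<partial>sphere_sigma TYPE('n)) \<le> 1"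
proof -
  let ?S = "sphere_sigma TYPE('n)" and ?d = "CARD('n)"
  interpret prob_space ?S by (rule prob_space_sphere_sigma)
  interpret nu: prob_space "nu_meas ?d" by (rule prob_space_nu_meas[OF d])
  let ?I = "\<integral>\<^sup>+ x. ennreal (\<Prod>k\<in>UNIV. sqrt (h k (x $ k))) \<partial>?S"
  have hm[measurable]: "h k \<in> borel_measurable borel" for k
    by (rule borel_measurable_continuous_onI[OF cont])
  have hint: "integrable (nu_meas ?d) (h k)" for k
    by (rule integrableI_nonneg) (use h0 h1[of k] in \<open>auto simp: less_top[symmetric] top_unique\<close>)
  have hint1: "(\<integral>t. h k t \<partial>nu_meas ?d) \<le> 1" for k
    using h1[of k] by (simp add: nn_integral_eq_integral[OF hint] h0)
  have bound: "?I \<le> ennreal ((sqrt (1 + 3 * \<delta>)) ^ ?d)" if \<delta>: "\<delta> > 0" for \<delta>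
  proof -
    \<comment> \<open>Approximating \<open>h k + 2 * \<delta>\<close> within \<open>\<delta>\<close>
      puts the polynomial above \<open>h k\<close> and makes it strictly positive, as the polynomial
      case demands, while its mean grows by at most \<open>3 * \<delta>\<close>.\<close>
    have "\<exists>p. \<forall>t\<in>{-1..1}. \<bar>h k t + 2 * \<delta> - poly p t\<bar> < \<delta>" for k
    proof -
      have "continuous_on {-1..1} (\<lambda>t. h k t + 2 * \<delta>)"
        by (intro continuous_intros continuous_on_subset[OF cont]) auto
      then obtain g where g: "real_polynomial_function g"
          "\<And>t. t \<in> {-1..1} \<Longrightarrow> \<bar>h k t + 2 * \<delta> - g t\<bar> < \<delta>"
        using Stone_Weierstrass_real_polynomial_function[of "{-1..1}" "\<lambda>t. h k t + 2 * \<delta>" \<delta>] \<delta> by auto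
      from g(1) obtain a n where "g = (\<lambda>t. \<Sum>i\<le>n. a i * t ^ i)"
        by (auto simp: real_polynomial_function_iff_sum)
      then have "g t = poly (\<Sum>i\<le>n. monom (a i) i) t" for t
        by (simp add: poly_sum poly_monom)
      with g(2) show ?thesis by metis
    qed
    then obtain p where p: "\<And>k t. t \<in> {-1..1} \<Longrightarrow> \<bar>h k t + 2 * \<delta> - poly (p k) t\<bar> < \<delta>" by metis
    have lo: "h k t \<le> poly (p k) t" "poly (p k) t > 0" and up: "poly (p k) t \<le> h k t + 3 * \<delta>"
      if "t \<in> {-1..1}" for k t
      using p[OF that, of k] h0[of k t] \<delta> by (auto simp: abs_if split: if_splits)
    have int_p: "integrable ?S (root_prod p)"
      by (rule integrable_sphere_sigma_continuous[OF continuous_on_root_prod]) (use lo in auto)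
    have "?I \<le> (\<integral>\<^sup>+ x. ennreal (root_prod p x) \<partial>?S)"
    proof (rule nn_integral_mono_AE)
      show "AE x in ?S. ennreal (\<Prod>k\<in>UNIV. sqrt (h k (x $ k))) \<le> ennreal (root_prod p x)"
        using AE_sphere_sigma
      proof eventually_elim
        case (elim x)
        then have "x $ k \<in> {-1..1}" for k by (rule sphere_component_mem)
        then show ?case
          using lo h0 by (subst root_prod_eq) (auto intro!: ennreal_leI prod_mono)
      qed
    qed
    also have "\<dots> = ennreal (\<integral>x. root_prod p x \<partial>?S)"
      by (rule nn_integral_eq_integral[OF int_p]) (simp add: root_prod_def)
    also have "\<dots> \<le> ennreal (\<Prod>k\<in>(UNIV::'n set). sqrt (1 + 3 * \<delta>))"
    proof (intro ennreal_leI order_trans[OF spherical_Brascamp_Lieb_poly[OF d]] prod_mono conjI)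
      fix k
      have "AE t in nu_meas ?d. 0 \<le> poly (p k) t"
        using AE_nu_meas[OF d] by eventually_elim (use lo in \<open>auto simp: less_imp_le\<close>)
      then show "0 \<le> sqrt (\<integral>t. poly (p k) t \<partial>nu_meas ?d)"
        by (simp add: integral_nonneg_AE)
      have "(\<integral>t. poly (p k) t \<partial>nu_meas ?d) \<le> (\<integral>t. h k t + 3 * \<delta> \<partial>nu_meas ?d)"
      proof (rule integral_mono_AE)
        show "AE t in nu_meas ?d. poly (p k) t \<le> h k t + 3 * \<delta>"
          using AE_nu_meas[OF d] by eventually_elim (rule up)
      qed (use hint integrable_nu_poly[OF d] in auto)
      also have "\<dots> \<le> 1 + 3 * \<delta>"
        using hint1[of k] hint[of k] nu.prob_space by simp
      finally show "sqrt (\<integral>t. poly (p k) t \<partial>nu_meas ?d) \<le> sqrt (1 + 3 * \<delta>)" by simp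
    qed (use lo in auto)
    finally show ?thesis by simp
  qed
  have "((\<lambda>\<delta>. ennreal ((sqrt (1 + 3 * \<delta>)) ^ ?d)) \<longlongrightarrow> ennreal ((sqrt (1 + 3 * 0)) ^ ?d)) (at_right 0)"
    by (intro tendsto_intros)
  from tendsto_lowerbound[OF this, of ?I] bound
  show ?thesis by (simp add: eventually_at_right_less eventually_at_right[of 0 1] exI[of _ 1])
qed

text \<open>A version of the Vitali--Caratheodory theorem: on each level set
  \<open>(1 + \<epsilon>)\<^sup>m \<le> h < (1 + \<epsilon>)\<^sup>m\<^sup>+\<^sup>1\<close>, cover by an open set of almost the same measure
  and approximate its indicator from below by continuous functions.\<close>

lemma continuous_eventual_majorant:
  fixes \<nu> :: "real measure" and h :: "real \<Rightarrow> real"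
  assumes fin: "finite_measure \<nu>" and sets_nu: "sets \<nu> = sets borel"
    and h[measurable]: "h \<in> borel_measurable borel" and h0: "\<And>t. h t \<ge> 0"
    and h1: "(\<integral>\<^sup>+ t. ennreal (h t) \<partial>\<nu>) \<le> 1" and \<epsilon>: "\<epsilon> > 0"
  obtains g :: "nat \<Rightarrow> real \<Rightarrow> real" where
    "\<And>n. continuous_on UNIV (g n)" "\<And>n t. g n t \<ge> 0"
    "\<And>n. (\<integral>\<^sup>+ t. ennreal (g n t) \<partial>\<nu>) \<le> ennreal (1 + \<epsilon>)"
    "\<And>t. t \<in> {-1..1} \<Longrightarrow> \<forall>\<^sub>F n in sequentially. h t \<le> (1 + \<epsilon>) * g n t"
proof -
  interpret finite_measure \<nu> by fact
  note sets_nu[measurable_cong]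
  \<comment> \<open>The levels run over all integers; \<open>int_encode\<close> numbers them by
    naturals, so that \<open>g n\<close> can use the first \<open>n\<close> of them.\<close>
  define lev where "lev = (\<lambda>t. int_encode \<lfloor>log (1 + \<epsilon>) (h t)\<rfloor>)"
  define c where "c = (\<lambda>m. (1 + \<epsilon>) powr real_of_int (int_decode m))"
  define A where "A = (\<lambda>m. {t. -1 \<le> t \<and> t \<le> 1 \<and> h t > 0 \<and> \<lfloor>log (1 + \<epsilon>) (h t)\<rfloor> = int_decode m})"
  have c0: "c m > 0" for m using \<epsilon> by (simp add: c_def)
  have A_borel[measurable]: "A m \<in> sets borel" for m unfolding A_def by measurable
  have lev: "m = lev t" if "t \<in> A m" for m t
    using that by (auto simp: A_def lev_def dest: sym)
  have in_A: "t \<in> A (lev t)" if "t \<in> {-1..1}" "h t > 0" for t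
    using that by (auto simp: A_def lev_def)
  have c_le: "c (lev t) \<le> h t" and c_ge: "h t \<le> (1 + \<epsilon>) * c (lev t)" if "h t > 0" for t
  proof -
    let ?l = "log (1 + \<epsilon>) (h t)"
    have h: "h t = (1 + \<epsilon>) powr ?l" using that \<epsilon> by simp
    have cl: "c (lev t) = (1 + \<epsilon>) powr of_int \<lfloor>?l\<rfloor>" by (simp add: c_def lev_def)
    have "(1 + \<epsilon>) powr of_int \<lfloor>?l\<rfloor> \<le> (1 + \<epsilon>) powr ?l"
      using \<epsilon> by (intro powr_mono) auto
    then show "c (lev t) \<le> h t" using h cl by simp
    have "(1 + \<epsilon>) powr ?l \<le> (1 + \<epsilon>) powr (1 + of_int \<lfloor>?l\<rfloor>)"
      using \<epsilon> by (intro powr_mono) linarith+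
    also have "\<dots> = (1 + \<epsilon>) * c (lev t)"
      using \<epsilon> by (simp add: powr_add cl)
    finally show "h t \<le> (1 + \<epsilon>) * c (lev t)" using h by simp
  qed
  \<comment> \<open>Dividing by the height \<open>c m\<close> compensates the factor in front of the
    indicator: the covering errors contribute at most \<open>\<epsilon>\<close> in total.\<close>
  define \<eta> where "\<eta> = (\<lambda>m. \<epsilon> / 2 ^ Suc m / c m)"
  have \<eta>: "\<eta> m > 0" for m using \<epsilon> c0 by (simp add: \<eta>_def)
  have "\<exists>U. open U \<and> A m \<subseteq> U \<and> emeasure \<nu> U \<le> emeasure \<nu> (A m) + ennreal (\<eta> m)" for m
  proof -
    have "emeasure \<nu> (A m) < emeasure \<nu> (A m) + ennreal (\<eta> m)"
      using \<eta>[of m]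
      by (simp add: emeasure_eq_measure ennreal_plus[symmetric] ennreal_less_iff del: ennreal_plus)
    moreover have "emeasure \<nu> (A m) = (INF U\<in>{U. A m \<subseteq> U \<and> open U}. emeasure \<nu> U)"
      by (rule outer_regular[OF sets_nu _ A_borel]) simp
    ultimately obtain U where "A m \<subseteq> U" "open U" "emeasure \<nu> U < emeasure \<nu> (A m) + ennreal (\<eta> m)"
      by (auto simp: INF_less_iff)
    then show ?thesis by (auto simp: less_imp_le)
  qed
  then obtain U where U: "\<And>m. open (U m)" "\<And>m. A m \<subseteq> U m"
      "\<And>m. emeasure \<nu> (U m) \<le> emeasure \<nu> (A m) + ennreal (\<eta> m)"
    by metis
  text \<open>Intersecting with a bounded interval keeps the complement nonempty, since
    \<open>infdist t {} = 0\<close>.\<close>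
  define V where "V = (\<lambda>m. U m \<inter> {-2<..<2})"
  have V: "open (V m)" "A m \<subseteq> V m" "3 \<in> - V m" for m
    using U by (auto simp: V_def A_def)
  have V_borel[measurable]: "V m \<in> sets borel" for m using V by simp
  have V_em: "emeasure \<nu> (V m) \<le> emeasure \<nu> (A m) + ennreal (\<eta> m)" for m
    by (rule order_trans[OF emeasure_mono U(3)]) (use U(1) in \<open>auto simp: V_def sets_nu\<close>)
  \<comment> \<open>At a point of the open set the value 1 is attained for all large
    \<open>n\<close>, not merely approached. Hence \<open>g\<close> dominates eventually at each
    point, with a threshold depending on the point.\<close>
  define \<phi> where "\<phi> = (\<lambda>m n t. min 1 (real n * infdist t (- V m)))"
  have \<phi>_cont: "continuous_on UNIV (\<phi> m n)" for m n
    unfolding \<phi>_def by (intro continuous_intros)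
  have \<phi>0: "\<phi> m n t \<ge> 0" for m n t by (simp add: \<phi>_def infdist_nonneg)
  have \<phi>_le: "\<phi> m n t \<le> indicator (V m) t" for m n t
    by (auto simp: \<phi>_def indicator_def)
  define g where "g = (\<lambda>n t. \<Sum>m<n. c m * \<phi> m n t)"
  show ?thesis
  proof (rule that[of g])
    show "continuous_on UNIV (g n)" for n
      unfolding g_def by (intro continuous_intros \<phi>_cont)
    show g0: "g n t \<ge> 0" for n t
      unfolding g_def by (intro sum_nonneg mult_nonneg_nonneg less_imp_le[OF c0] \<phi>0)
    show "(\<integral>\<^sup>+ t. ennreal (g n t) \<partial>\<nu>) \<le> ennreal (1 + \<epsilon>)" for n
    proof -
      have "(\<integral>\<^sup>+ t. ennreal (g n t) \<partial>\<nu>) \<le> (\<integral>\<^sup>+ t. (\<Sum>m<n. ennreal (c m) * indicator (V m) t) \<partial>\<nu>)"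
      proof (rule nn_integral_mono)
        fix t
        have "g n t \<le> (\<Sum>m<n. c m * indicator (V m) t)"
          unfolding g_def by (intro sum_mono mult_left_mono \<phi>_le less_imp_le[OF c0])
        then have "ennreal (g n t) \<le> ennreal (\<Sum>m<n. c m * indicator (V m) t)"
          by (rule ennreal_leI)
        also have "\<dots> = (\<Sum>m<n. ennreal (c m) * indicator (V m) t)"
          using c0 by (subst sum_ennreal[symmetric])
            (auto simp: ennreal_mult less_imp_le ennreal_indicator)
        finally show "ennreal (g n t) \<le> (\<Sum>m<n. ennreal (c m) * indicator (V m) t)" .
      qed
      also have "\<dots> = (\<Sum>m<n. ennreal (c m) * emeasure \<nu> (V m))"
        by (subst nn_integral_sum) (auto simp: nn_integral_cmult sets_nu)
      also have "\<dots> \<le> (\<Sum>m<n. ennreal (c m) * emeasure \<nu> (A m) + ennreal (\<epsilon> / 2 ^ Suc m))"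
      proof (rule sum_mono)
        fix m
        have "ennreal (c m) * emeasure \<nu> (V m) \<le> ennreal (c m) * (emeasure \<nu> (A m) + ennreal (\<eta> m))"
          by (intro mult_left_mono V_em) auto
        also have "\<dots> = ennreal (c m) * emeasure \<nu> (A m) + ennreal (c m * \<eta> m)"
          using c0[of m] by (simp add: distrib_left ennreal_mult less_imp_le \<eta>)
        also have "c m * \<eta> m = \<epsilon> / 2 ^ Suc m"
          using c0[of m] by (simp add: \<eta>_def)
        finally show "ennreal (c m) * emeasure \<nu> (V m)
            \<le> ennreal (c m) * emeasure \<nu> (A m) + ennreal (\<epsilon> / 2 ^ Suc m)" .
      qed
      also have "\<dots> = (\<Sum>m<n. ennreal (c m) * emeasure \<nu> (A m)) + (\<Sum>m<n. ennreal (\<epsilon> / 2 ^ Suc m))"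
        by (rule sum.distrib)
      also have "(\<Sum>m<n. ennreal (\<epsilon> / 2 ^ Suc m)) = ennreal (\<Sum>m<n. \<epsilon> / 2 ^ Suc m)"
        using \<epsilon> by (intro sum_ennreal) auto
      also have "(\<Sum>m<n. \<epsilon> / 2 ^ Suc m) = \<epsilon> * (1 - 1 / 2 ^ n)"
        by (induction n) (auto simp: field_simps)
      also have "ennreal (\<epsilon> * (1 - 1 / 2 ^ n)) \<le> ennreal \<epsilon>"
        using \<epsilon> by (intro ennreal_leI) (simp add: mult_left_le)
      also have "(\<Sum>m<n. ennreal (c m) * emeasure \<nu> (A m)) = (\<integral>\<^sup>+ t. (\<Sum>m<n. ennreal (c m) * indicator (A m) t) \<partial>\<nu>)"
        by (subst nn_integral_sum) (auto simp: nn_integral_cmult sets_nu)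
      also have "\<dots> \<le> (\<integral>\<^sup>+ t. ennreal (h t) \<partial>\<nu>)"
      proof (rule nn_integral_mono)
        fix t
        have "(\<Sum>m<n. ennreal (c m) * indicator (A m) t) \<le> (\<Sum>m<n. if m = lev t then ennreal (h t) else 0)"
        proof (rule sum_mono)
          fix m
          show "ennreal (c m) * indicator (A m) t \<le> (if m = lev t then ennreal (h t) else 0)"
          proof (cases "t \<in> A m")
            case True
            then have "h t > 0" by (simp add: A_def)
            with c_le lev[OF True] have "c m \<le> h t" by metis
            then show ?thesis using lev[OF True] True by (simp only: indicator_simps) (simp add: ennreal_leI)
          qed simp
        qed
        also have "\<dots> \<le> ennreal (h t)" by (simp add: sum.delta)
        finally show "(\<Sum>m<n. ennreal (c m) * indicator (A m) t) \<le> ennreal (h t)" .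
      qed
      also note h1
      finally show ?thesis
        using \<epsilon> by (simp add: add_right_mono add_mono)
    qed
    show "\<forall>\<^sub>F n in sequentially. h t \<le> (1 + \<epsilon>) * g n t" if t: "t \<in> {-1..1}" for t
    proof (cases "h t > 0")
      case False
      then show ?thesis using g0 \<epsilon> h0[of t] by (auto intro!: always_eventually mult_nonneg_nonneg)
    next
      case True
      define m where "m = lev t"
      have tV: "t \<in> V m" using in_A[OF t True] V(2) by (auto simp: m_def)
      have "infdist t (- V m) \<noteq> 0"
      proof -
        have "closed (- V m)" "- V m \<noteq> {}" using V(1,3)[of m] by (auto simp: closed_def)
        then show ?thesis using in_closed_iff_infdist_zero[of "- V m" t] tV by simp
      qed
      then have pos: "infdist t (- V m) > 0" using infdist_nonneg[of t "- V m"] by simp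
      then obtain n0 where n0: "1 \<le> real n0 * infdist t (- V m)"
        using reals_Archimedean3[of "infdist t (- V m)"] by (meson less_imp_le)
      show ?thesis
      proof (rule eventually_sequentiallyI[of "max (Suc m) n0"])
        fix n assume n: "max (Suc m) n0 \<le> n"
        have "real n0 * infdist t (- V m) \<le> real n * infdist t (- V m)"
          using n pos by (intro mult_right_mono) auto
        then have "\<phi> m n t = 1" using n0 by (simp add: \<phi>_def)
        then have "c m = c m * \<phi> m n t" by simp
        also have "\<dots> \<le> g n t"
          unfolding g_def using n by (intro member_le_sum mult_nonneg_nonneg less_imp_le[OF c0] \<phi>0) auto
        finally show "h t \<le> (1 + \<epsilon>) * g n t"
          using c_ge[OF True] \<epsilon> by (auto simp: m_def intro: order_trans mult_left_mono)
      qed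
    qed
  qed
qed

text \<open>The domination by continuous functions is pointwise and eventual, which is what Fatou's
  lemma can use. Each factor loses \<open>1 + \<epsilon>\<close> twice, from domination and from
  renormalization, and the square root leaves one factor \<open>1 + \<epsilon>\<close> per
  coordinate.\<close>

theorem spherical_Brascamp_Lieb:
  fixes h :: "'n::finite \<Rightarrow> real \<Rightarrow> real"
  assumes d: "CARD('n) \<ge> 2" and h[measurable]: "\<And>k. h k \<in> borel_measurable borel"
    and h0: "\<And>k t. h k t \<ge> 0"
    and h1: "\<And>k. (\<integral>\<^sup>+ t. ennreal (h k t) \<partial>nu_meas CARD('n)) \<le> 1"
  shows "(\<integral>\<^sup>+ x. ennreal (\<Prod>k\<in>UNIV. sqrt (h k (x $ k))) \<partial>sphere_sigma TYPE('n)) \<le> 1"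
proof -
  let ?S = "sphere_sigma TYPE('n)" and ?d = "CARD('n)"
  let ?I = "\<integral>\<^sup>+ x. ennreal (\<Prod>k\<in>UNIV. sqrt (h k (x $ k))) \<partial>?S"
  interpret nu: prob_space "nu_meas ?d" by (rule prob_space_nu_meas[OF d])
  have bound: "?I \<le> ennreal ((1 + \<epsilon>) ^ ?d)" if \<epsilon>: "\<epsilon> > 0" for \<epsilon>
  proof -
    have "\<exists>g. (\<forall>n. continuous_on UNIV (g n)) \<and> (\<forall>n t. g n t \<ge> (0::real)) \<and>
      (\<forall>n. (\<integral>\<^sup>+ t. ennreal (g n t) \<partial>nu_meas ?d) \<le> ennreal (1 + \<epsilon>)) \<and>
      (\<forall>t\<in>{-1..1}. \<forall>\<^sub>F n in sequentially. h k t \<le> (1 + \<epsilon>) * g n t)" for k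
      using continuous_eventual_majorant[OF nu.finite_measure_axioms sets_nu_meas h h0 h1 \<epsilon>, of k]
      by metis
    then obtain g where g: "\<And>k n. continuous_on UNIV (g k n)" "\<And>k n t. g k n t \<ge> (0::real)"
      "\<And>k n. (\<integral>\<^sup>+ t. ennreal (g k n t) \<partial>nu_meas ?d) \<le> ennreal (1 + \<epsilon>)"
      "\<And>k t. t \<in> {-1..1} \<Longrightarrow> \<forall>\<^sub>F n in sequentially. h k t \<le> (1 + \<epsilon>) * g k n t"
      by metis
    define w where "w = (\<lambda>n (x::real^'n). \<Prod>k\<in>UNIV. sqrt (g k n (x $ k) / (1 + \<epsilon>)))"
    have [measurable]: "g k n \<in> borel_measurable borel" for k n
      by (rule borel_measurable_continuous_onI[OF g(1)])
    have [measurable]: "w n \<in> borel_measurable borel" for n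
      unfolding w_def by measurable
    have w: "(\<integral>\<^sup>+ x. ennreal (w n x) \<partial>?S) \<le> 1" for n
      unfolding w_def
    proof (rule spherical_Brascamp_Lieb_continuous[OF d])
      fix k
      show "continuous_on UNIV (\<lambda>t. g k n t / (1 + \<epsilon>))"
        using \<epsilon> by (intro continuous_intros g(1)) auto
      show "g k n t / (1 + \<epsilon>) \<ge> 0" for t using g(2) \<epsilon> by simp
      have "(\<integral>\<^sup>+ t. ennreal (g k n t / (1 + \<epsilon>)) \<partial>nu_meas ?d)
          = (\<integral>\<^sup>+ t. ennreal (1 / (1 + \<epsilon>)) * ennreal (g k n t) \<partial>nu_meas ?d)"
        using \<epsilon> g(2) by (intro nn_integral_cong) (simp add: ennreal_mult'[symmetric])
      also have "\<dots> = ennreal (1 / (1 + \<epsilon>)) * (\<integral>\<^sup>+ t. ennreal (g k n t) \<partial>nu_meas ?d)"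
        by (rule nn_integral_cmult) simp
      also have "\<dots> \<le> ennreal (1 / (1 + \<epsilon>)) * ennreal (1 + \<epsilon>)"
        by (intro mult_left_mono g(3)) auto
      also have "\<dots> = 1" using \<epsilon> by (simp add: ennreal_mult'[symmetric] del: ennreal_plus)
      finally show "(\<integral>\<^sup>+ t. ennreal (g k n t / (1 + \<epsilon>)) \<partial>nu_meas ?d) \<le> 1" .
    qed
    have "?I \<le> (\<integral>\<^sup>+ x. liminf (\<lambda>n. ennreal ((1 + \<epsilon>) ^ ?d) * ennreal (w n x)) \<partial>?S)"
    proof (rule nn_integral_mono_AE)
      show "AE x in ?S. ennreal (\<Prod>k\<in>UNIV. sqrt (h k (x $ k)))
          \<le> liminf (\<lambda>n. ennreal ((1 + \<epsilon>) ^ ?d) * ennreal (w n x))"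
        using AE_sphere_sigma
      proof eventually_elim
        case (elim x)
        have "\<forall>\<^sub>F n in sequentially. \<forall>k. h k (x $ k) \<le> (1 + \<epsilon>) * g k n (x $ k)"
          by (intro eventually_all_finite g(4) sphere_component_mem[OF elim])
        then have "\<forall>\<^sub>F n in sequentially. ennreal (\<Prod>k\<in>UNIV. sqrt (h k (x $ k)))
            \<le> ennreal ((1 + \<epsilon>) ^ ?d) * ennreal (w n x)"
        proof eventually_elim
          case (elim n)
          have "(\<Prod>k\<in>UNIV. sqrt (h k (x $ k))) \<le> (\<Prod>k\<in>UNIV. (1 + \<epsilon>) * sqrt (g k n (x $ k) / (1 + \<epsilon>)))"
          proof (intro prod_mono conjI)
            fix k
            have "h k (x $ k) \<le> (1 + \<epsilon>)\<^sup>2 * (g k n (x $ k) / (1 + \<epsilon>))"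
              using elim[rule_format, of k] \<epsilon> by (simp add: power2_eq_square)
            then have "sqrt (h k (x $ k)) \<le> sqrt ((1 + \<epsilon>)\<^sup>2 * (g k n (x $ k) / (1 + \<epsilon>)))"
              by simp
            also have "\<dots> = (1 + \<epsilon>) * sqrt (g k n (x $ k) / (1 + \<epsilon>))"
              using \<epsilon> by (simp only: real_sqrt_mult real_sqrt_abs)
            finally show "sqrt (h k (x $ k)) \<le> (1 + \<epsilon>) * sqrt (g k n (x $ k) / (1 + \<epsilon>))" .
          qed (simp add: h0)
          also have "\<dots> = (1 + \<epsilon>) ^ ?d * w n x"
            by (simp add: prod.distrib w_def)
          finally show ?case
            using \<epsilon> by (simp add: ennreal_mult'[symmetric] ennreal_leI)
        qed
        then show ?case by (rule Liminf_bounded)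
      qed
    qed
    also have "\<dots> \<le> liminf (\<lambda>n. \<integral>\<^sup>+ x. ennreal ((1 + \<epsilon>) ^ ?d) * ennreal (w n x) \<partial>?S)"
      by (rule nn_integral_liminf) simp
    also have "\<dots> \<le> ennreal ((1 + \<epsilon>) ^ ?d)"
    proof (rule Liminf_le)
      have "(\<integral>\<^sup>+ x. ennreal ((1 + \<epsilon>) ^ ?d) * ennreal (w n x) \<partial>?S) \<le> ennreal ((1 + \<epsilon>) ^ ?d) * 1" for n
        unfolding nn_integral_cmult[OF measurable_compose[OF \<open>w n \<in> _\<close>[simplified measurable_cong_sets[OF sets_sphere_sigma[symmetric] refl]] measurable_ennreal]]
        by (intro mult_left_mono w) auto
      then show "\<forall>\<^sub>F n in sequentially. (\<integral>\<^sup>+ x. ennreal ((1 + \<epsilon>) ^ ?d) * ennreal (w n x) \<partial>?S) \<le> ennreal ((1 + \<epsilon>) ^ ?d)"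
        by simp
    qed simp
    finally show ?thesis .
  qed
  have "((\<lambda>\<epsilon>. ennreal ((1 + \<epsilon>) ^ ?d)) \<longlongrightarrow> ennreal ((1 + 0) ^ ?d)) (at_right 0)"
    by (intro tendsto_intros)
  from tendsto_lowerbound[OF this, of ?I] bound
  show ?thesis by (simp add: eventually_at_right[of 0 1] exI[of _ 1])
qed

section \<open>Random orthonormal frames\<close>

text \<open>A vector in the span of its predecessors yields 0, because \<open>sgn 0 = 0\<close>.
  Pairwise orthogonality and equivariance therefore hold for every sequence, and degeneracy becomes
  a question of null sets.\<close>

function gram_schmidt :: "(nat \<Rightarrow> 'a::real_inner) \<Rightarrow> nat \<Rightarrow> 'a" where
  "gram_schmidt X k = sgn (X k - (\<Sum>i<k. (X k \<bullet> gram_schmidt X i) *\<^sub>R gram_schmidt X i))"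
  by auto
termination by (relation "Wellfounded.measure snd") auto

declare gram_schmidt.simps [simp del]

lemma norm_gram_schmidt: "gram_schmidt X k = 0 \<or> norm (gram_schmidt X k) = 1"
  by (subst (1 2) gram_schmidt.simps) (auto simp: norm_sgn sgn_zero_iff)

lemma gram_schmidt_orthogonal_less:
  "i < j \<Longrightarrow> gram_schmidt X i \<bullet> gram_schmidt X j = 0"
proof (induction j arbitrary: i rule: less_induct)
  case (less j)
  let ?e = "gram_schmidt X"
  have IH: "?e a \<bullet> ?e b = 0" if "a < j" "b < j" "a \<noteq> b" for a b
    using less.IH[of b a] less.IH[of a b] that by (cases "a < b") (auto simp: inner_commute)
  have "?e i \<bullet> (\<Sum>l<j. (X j \<bullet> ?e l) *\<^sub>R ?e l) = (\<Sum>l<j. (X j \<bullet> ?e l) * (?e i \<bullet> ?e l))"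
    by (simp add: inner_sum_right)
  also have "\<dots> = (\<Sum>l<j. if l = i then (X j \<bullet> ?e i) * (?e i \<bullet> ?e i) else 0)"
    using IH less.prems by (intro sum.cong) auto
  also have "\<dots> = (X j \<bullet> ?e i) * (?e i \<bullet> ?e i)"
    using less.prems by simp
  also have "\<dots> = ?e i \<bullet> X j"
    using norm_gram_schmidt[of X i] by (auto simp: inner_commute norm_eq_1)
  finally show ?case
    by (subst (2) gram_schmidt.simps) (simp add: sgn_div_norm inner_diff_right)
qed

lemma gram_schmidt_orthogonal:
  "i \<noteq> j \<Longrightarrow> gram_schmidt X i \<bullet> gram_schmidt X j = 0"
  using gram_schmidt_orthogonal_less[of i j X] gram_schmidt_orthogonal_less[of j i X]
  by (cases "i < j") (auto simp: inner_commute)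

text \<open>Used to change entries that the first vectors do not see: a later vector in a Fubini
  argument, or the values that \<open>compose\<close> leaves undefined outside the index
  set.\<close>

lemma gram_schmidt_cong:
  "(\<And>i. i \<le> k \<Longrightarrow> X i = Y i) \<Longrightarrow> gram_schmidt X k = gram_schmidt Y k"
proof (induction k rule: less_induct)
  case (less k)
  then have "gram_schmidt X i = gram_schmidt Y i" if "i < k" for i
    using that by auto
  then show ?case
    using less.prems by (subst (1 2) gram_schmidt.simps) (auto intro!: arg_cong[where f=sgn] sum.cong)
qed

lemma gram_schmidt_orthogonal_transformation:
  assumes T: "orthogonal_transformation T"
  shows "gram_schmidt (\<lambda>i. T (X i)) k = T (gram_schmidt X k)"
proof (induction k rule: less_induct)
  case (less k)
  have lin: "linear T" and ip: "\<And>u v. T u \<bullet> T v = u \<bullet> v" and n: "\<And>v. norm (T v) = norm v"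
    using T by (auto simp: orthogonal_transformation_def orthogonal_transformation_norm)
  define w where "w = X k - (\<Sum>i<k. (X k \<bullet> gram_schmidt X i) *\<^sub>R gram_schmidt X i)"
  have "T (X k) - (\<Sum>i<k. (T (X k) \<bullet> gram_schmidt (\<lambda>i. T (X i)) i) *\<^sub>R gram_schmidt (\<lambda>i. T (X i)) i) = T w"
    by (simp add: w_def less ip linear_diff[OF lin] linear_sum[OF lin] linear_cmul[OF lin])
  then have "gram_schmidt (\<lambda>i. T (X i)) k = sgn (T w)"
    by (subst gram_schmidt.simps) simp
  also have "\<dots> = T (sgn w)"
    by (simp add: sgn_div_norm n linear_cmul[OF lin])
  also have "sgn w = gram_schmidt X k"
    by (subst gram_schmidt.simps) (simp add: w_def)
  finally show ?case .
qed

lemma borel_measurable_gram_schmidt: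
  "k < d \<Longrightarrow> (\<lambda>X. gram_schmidt X k :: 'a::euclidean_space) \<in> borel_measurable (PiM {..<d} (\<lambda>_. borel))"
proof (induction k rule: less_induct)
  case (less k)
  have [measurable]: "(\<lambda>X. X k) \<in> borel_measurable (PiM {..<d} (\<lambda>_. borel :: 'a measure))"
    using less.prems by (intro measurable_component_singleton) simp
  have [measurable]: "(\<lambda>X. gram_schmidt X i :: 'a) \<in> borel_measurable (PiM {..<d} (\<lambda>_. borel))"
    if "i \<in> {..<k}" for i
    using less that by auto
  show ?case
    by (subst gram_schmidt.simps) measurable
qed

section \<open>Nondegeneracy and invariance of random frames\<close>

abbreviation ball_seq :: "nat \<Rightarrow> (nat \<Rightarrow> 'a::euclidean_space) measure" where
  "ball_seq d \<equiv> PiM {..<d} (\<lambda>_. unit_ball_unif)"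

lemma product_prob_space_unit_ball_unif:
  "product_prob_space (\<lambda>_::nat. unit_ball_unif :: 'a::euclidean_space measure)"
  by (intro product_prob_spaceI prob_space_unit_ball_unif)

lemma sets_ball_seq [measurable_cong]: "sets (ball_seq d) = sets (PiM {..<d} (\<lambda>_. borel))"
  by (intro sets_PiM_cong) auto

lemma borel_measurable_gram_schmidt_ball_seq:
  "k < d \<Longrightarrow> (\<lambda>X. gram_schmidt X k) \<in> borel_measurable (ball_seq d)"
  unfolding measurable_cong_sets[OF sets_ball_seq refl] by (rule borel_measurable_gram_schmidt)

text \<open>With all vectors but the \<open>k\<close>-th fixed, failure forces that vector into the
  span of at most \<open>k\<close> earlier ones, a proper subspace and hence a null set. Fubini does
  the rest.\<close>

lemma AE_gram_schmidt_nonzero: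
  assumes k: "k < DIM('a)"
  shows "AE X in ball_seq DIM('a). gram_schmidt X k \<noteq> (0::'a::euclidean_space)"
proof -
  interpret product_prob_space "\<lambda>_::nat. unit_ball_unif :: 'a measure"
    by (rule product_prob_space_unit_ball_unif)
  let ?d = "DIM('a)"
  let ?I = "{..<?d} - {k}"
  have [measurable]: "(\<lambda>X. gram_schmidt X k :: 'a) \<in> borel_measurable (ball_seq ?d)"
    by (rule borel_measurable_gram_schmidt_ball_seq[OF k])
  define Z where "Z = {X \<in> space (ball_seq ?d). gram_schmidt X k = (0::'a)}"
  have Z: "Z \<in> sets (ball_seq ?d)" unfolding Z_def by measurable
  have I: "{..<?d} = insert k ?I" using k by auto
  have "emeasure (ball_seq ?d) Z = (\<integral>\<^sup>+ X. indicator Z X \<partial>ball_seq ?d)"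
    using Z by simp
  also have "\<dots> = (\<integral>\<^sup>+ X. (\<integral>\<^sup>+ y. indicator Z (X(k := y)) \<partial>unit_ball_unif) \<partial>PiM ?I (\<lambda>_. unit_ball_unif))"
  proof -
    have "indicator Z \<in> borel_measurable (PiM (insert k ?I) (\<lambda>_. unit_ball_unif :: 'a measure))"
      unfolding I[symmetric] using Z by (rule borel_measurable_indicator)
    then have "(\<integral>\<^sup>+ X. indicator Z X \<partial>PiM (insert k ?I) (\<lambda>_. unit_ball_unif))
        = (\<integral>\<^sup>+ X. (\<integral>\<^sup>+ y. indicator Z (X(k := y)) \<partial>unit_ball_unif) \<partial>PiM ?I (\<lambda>_. unit_ball_unif))"
      by (intro product_nn_integral_insert) auto
    then show ?thesis unfolding I[symmetric] .
  qed
  also have "\<dots> = (\<integral>\<^sup>+ X. 0 \<partial>PiM ?I (\<lambda>_. unit_ball_unif :: 'a measure))"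
  proof (rule nn_integral_cong)
    fix X :: "nat \<Rightarrow> 'a"
    define L where "L = span (gram_schmidt X ` {..<k})"
    have "dim L \<le> card (gram_schmidt X ` {..<k})"
      unfolding L_def by (simp add: dim_le_card')
    also have "\<dots> \<le> k" using card_image_le[of "{..<k}" "gram_schmidt X"] by simp
    finally have "negligible L" using k by (intro negligible_lowdim) simp
    moreover have L: "L \<in> sets borel" unfolding L_def by (simp add: closed_subspace borel_closed)
    ultimately have null: "emeasure lborel L = 0"
      by (simp add: negligible_iff_null_sets null_sets_def)
    have "emeasure unit_ball_unif L \<le> 0"
      using emeasure_mono[of "ball 0 1 \<inter> L" L lborel] L null
      unfolding unit_ball_unif_def by (subst emeasure_uniform_measure) auto
    moreover have "(\<integral>\<^sup>+ y. indicator Z (X(k := y)) \<partial>unit_ball_unif) \<le> (\<integral>\<^sup>+ y. indicator L y \<partial>unit_ball_unif)"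
    proof (rule nn_integral_mono)
      fix y
      have "y \<in> L" if "gram_schmidt (X(k := y)) k = 0"
      proof -
        have e: "gram_schmidt (X(k := y)) i = gram_schmidt X i" if "i < k" for i
          using that by (intro gram_schmidt_cong) auto
        have "y = (\<Sum>i<k. (y \<bullet> gram_schmidt X i) *\<^sub>R gram_schmidt X i)"
          using that by (subst (asm) gram_schmidt.simps) (simp add: sgn_zero_iff e)
        also have "\<dots> \<in> L"
          unfolding L_def by (intro span_sum span_scale span_base) auto
        finally show ?thesis .
      qed
      then show "indicator Z (X(k := y)) \<le> (indicator L y :: ennreal)"
        by (auto simp: Z_def indicator_def)
    qed
    ultimately show "(\<integral>\<^sup>+ y. indicator Z (X(k := y)) \<partial>unit_ball_unif) = 0"
      using L by simp
  qed
  finally have "emeasure (ball_seq ?d) Z = 0" by simp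
  with Z have "Z \<in> null_sets (ball_seq ?d)" by blast
  then show ?thesis
    by (rule AE_I') (auto simp: Z_def)
qed

lemma AE_gram_schmidt_all_nonzero:
  "AE X in ball_seq CARD('n::finite). \<forall>k\<in>{..<CARD('n)}. gram_schmidt X k \<noteq> (0::real^'n)"
proof -
  have dim: "DIM(real^'n) = CARD('n)" by simp
  show ?thesis
    using AE_gram_schmidt_nonzero[where 'a="real^'n", unfolded dim] by (subst AE_finite_all) auto
qed

lemma distr_ball_seq_orthogonal:
  fixes T :: "'a::euclidean_space \<Rightarrow> 'a"
  assumes T: "orthogonal_transformation T"
  shows "distr (ball_seq d) (ball_seq d) (compose {..<d} T) = ball_seq d"
proof -
  have "distr (ball_seq d) (ball_seq d) (compose {..<d} T)
      = PiM {..<d} (\<lambda>_. distr unit_ball_unif unit_ball_unif T)"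
    by (rule distr_PiM_finite_prob_space)
       (auto intro!: product_prob_space_unit_ball_unif
          simp: orthogonal_transformation_borel[OF T] cong: measurable_cong_sets)
  also have "distr unit_ball_unif unit_ball_unif T = distr unit_ball_unif borel T"
    by (rule distr_cong) auto
  finally show ?thesis by (simp add: distr_unit_ball_unif_orthogonal[OF T])
qed

text \<open>The frame is used through its transpose: since the law of \<open>X\<close> is invariant under
  orthogonal maps, \<open>frame_coords X v\<close> has the same law for all unit vectors \<open>v\<close>. That law is
  \<open>\<sigma>\<close>, because it is preserved by averaging over \<open>v\<close>. The images of the standard basis vectors
  are orthonormal.\<close>

definition index_nat :: "'n::finite \<Rightarrow> nat" where
  "index_nat = (SOME r. bij_betw r UNIV {..<CARD('n)})"

lemma bij_index_nat: "bij_betw (index_nat :: 'n::finite \<Rightarrow> nat) UNIV {..<CARD('n)}"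
proof -
  have "\<exists>r. bij_betw r (UNIV :: 'n set) {..<CARD('n)}"
    using ex_bij_betw_finite_nat[of "UNIV :: 'n set"] by (simp add: atLeast0LessThan)
  then show ?thesis unfolding index_nat_def by (rule someI_ex)
qed

definition frame_coords :: "(nat \<Rightarrow> real^'n) \<Rightarrow> real^'n \<Rightarrow> real^'n::finite" where
  "frame_coords X v = (\<Sum>k\<in>UNIV. (gram_schmidt X (index_nat k) \<bullet> v) *\<^sub>R axis k 1)"

lemma frame_coords_nth: "frame_coords X v $ k = gram_schmidt X (index_nat k) \<bullet> v"
  by (simp add: frame_coords_def axis_def if_distrib cong: if_cong)

text \<open>The synthesis map \<open>W\<close> is isometric by orthonormality, and in finite
  dimension it is then invertible. Identifying \<open>frame_coords X\<close> with its inverse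
  supplies completeness of the frame.\<close>

lemma frame_coords_orthogonal:
  fixes X :: "nat \<Rightarrow> real^'n::finite"
  assumes nz: "\<And>k. k < CARD('n) \<Longrightarrow> gram_schmidt X k \<noteq> 0"
  shows "orthogonal_transformation (frame_coords X)"
proof -
  have lt: "index_nat (k::'n) < CARD('n)" for k
    using bij_index_nat[where 'n='n] by (auto simp: bij_betw_def)
  have inj: "index_nat (k::'n) = index_nat l \<longleftrightarrow> k = l" for k l
    using bij_index_nat[where 'n='n] by (auto simp: bij_betw_def inj_on_def)
  define e where "e = (\<lambda>k::'n. gram_schmidt X (index_nat k))"
  have ee: "e k \<bullet> e l = (if k = l then 1 else 0)" for k l
    using gram_schmidt_orthogonal[of "index_nat k" "index_nat l" X] norm_gram_schmidt[of X "index_nat k"] nz[OF lt[of k]]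
    by (auto simp: e_def inj norm_eq_1)
  define W where "W = (\<lambda>a::real^'n. \<Sum>k\<in>UNIV. (a $ k) *\<^sub>R e k)"
  have eW: "e k \<bullet> W a = a $ k" for k a
    by (simp add: W_def inner_sum_right ee if_distrib cong: if_cong)
  have linW: "linear W"
    unfolding W_def by (rule linearI) (auto simp: scaleR_add_left sum.distrib scaleR_sum_right)
  have "W a \<bullet> W b = a \<bullet> b" for a b
  proof -
    have "W a \<bullet> W b = (\<Sum>k\<in>UNIV. a $ k * (e k \<bullet> W b))"
      by (subst W_def) (simp add: inner_sum_left)
    then show ?thesis unfolding eW by (simp add: inner_vec_def)
  qed
  with linW have "orthogonal_transformation W"
    by (simp add: orthogonal_transformation_def)
  then obtain S where S: "orthogonal_transformation S" "\<And>x. S (W x) = x" "\<And>x. W (S x) = x"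
    using orthogonal_transformation_inv_ex by blast
  have "frame_coords X v = S v" for v
    using eW[of _ "S v"] by (simp add: vec_eq_iff frame_coords_nth e_def S)
  then show ?thesis using S(1) by (simp add: ext[of "frame_coords X" S])
qed

lemma borel_measurable_frame_coords [measurable]:
  "(\<lambda>(X, v). frame_coords X v :: real^'n::finite) \<in> borel_measurable (ball_seq CARD('n) \<Otimes>\<^sub>M borel)"
proof -
  have "index_nat (k::'n) < CARD('n)" for k
    using bij_index_nat[where 'n='n] by (auto simp: bij_betw_def)
  then have [measurable]: "(\<lambda>X. gram_schmidt X (index_nat k)) \<in> borel_measurable (ball_seq CARD('n))" for k :: 'n
    by (intro borel_measurable_gram_schmidt_ball_seq)
  show ?thesis
    unfolding frame_coords_def case_prod_beta' by measurable
qed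

lemma nn_integral_frame_coords:
  fixes \<Phi> :: "real^'n::finite \<Rightarrow> ennreal"
  assumes \<Phi>[measurable]: "\<Phi> \<in> borel_measurable borel" and v: "norm v = 1"
  shows "(\<integral>\<^sup>+ X. \<Phi> (frame_coords X v) \<partial>ball_seq CARD('n)) = (\<integral>\<^sup>+ x. \<Phi> x \<partial>sphere_sigma TYPE('n))"
proof -
  let ?P = "ball_seq CARD('n) :: (nat \<Rightarrow> real^'n) measure" and ?S = "sphere_sigma TYPE('n)"
  interpret PP: product_prob_space "\<lambda>_::nat. unit_ball_unif :: (real^'n) measure"
    by (rule product_prob_space_unit_ball_unif)
  interpret P: prob_space ?P by (intro prob_space_PiM prob_space_unit_ball_unif)
  interpret S: prob_space ?S by (rule prob_space_sphere_sigma)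
  interpret PS: pair_sigma_finite ?P ?S ..
  define J where "J = (\<lambda>v. \<integral>\<^sup>+ X. \<Phi> (frame_coords X v) \<partial>?P)"
  have meas: "(\<lambda>(X, v). \<Phi> (frame_coords X v)) \<in> borel_measurable (?P \<Otimes>\<^sub>M ?S)"
    using measurable_compose[OF borel_measurable_frame_coords \<Phi>]
    by (simp add: case_prod_beta' cong: measurable_cong_sets sets_pair_measure_cong)
  have meas_v: "(\<lambda>X. \<Phi> (frame_coords X u)) \<in> borel_measurable ?P" for u
    using measurable_compose[OF measurable_Pair2'[of u ?S ?P] meas] by simp
  have J_inv: "J (T u) = J u" if T: "orthogonal_transformation T" for T u
  proof -
    obtain S where S: "orthogonal_transformation S" "\<And>x. S (T x) = x" "\<And>x. T (S x) = x"
      using orthogonal_transformation_inv_ex[OF T] by blast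
    have lt: "index_nat (k::'n) < CARD('n)" for k
      using bij_index_nat[where 'n='n] by (auto simp: bij_betw_def)
    \<comment> \<open>Moving \<open>T\<close> across the inner product applies its inverse
      \<open>S\<close> to the frame vectors, and Gram--Schmidt commutes with
      \<open>S\<close>.\<close>
    have "frame_coords X (T u) = frame_coords (compose {..<CARD('n)} S X) u" for X
    proof -
      have "gram_schmidt (compose {..<CARD('n)} S X) (index_nat k) = S (gram_schmidt X (index_nat k))" for k :: 'n
        unfolding gram_schmidt_orthogonal_transformation[OF S(1), symmetric]
        using lt[of k] by (intro gram_schmidt_cong) (auto simp: compose_def)
      moreover have "S a \<bullet> u = a \<bullet> T u" for a
        using S(1) S(2)[of u] unfolding orthogonal_transformation_def by metis
      ultimately show ?thesis
        by (intro vec_eq_iff[THEN iffD2] allI) (simp add: frame_coords_nth)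
    qed
    then have "J (T u) = (\<integral>\<^sup>+ X. \<Phi> (frame_coords (compose {..<CARD('n)} S X) u) \<partial>?P)"
      by (simp add: J_def)
    also have "\<dots> = (\<integral>\<^sup>+ X. \<Phi> (frame_coords X u) \<partial>distr ?P ?P (compose {..<CARD('n)} S))"
    proof (rule nn_integral_distr[symmetric])
      have "compose {..<CARD('n)} S = (\<lambda>X. \<lambda>i\<in>{..<CARD('n)}. S (X i))" by (simp add: compose_def fun_eq_iff)
      then show "compose {..<CARD('n)} S \<in> measurable ?P ?P"
        using orthogonal_transformation_borel[OF S(1)]
        by (auto intro!: measurable_restrict measurable_compose[OF measurable_component_singleton]
            cong: measurable_cong_sets)
    qed (use meas_v in simp)
    also have "\<dots> = J u" by (simp add: J_def distr_ball_seq_orthogonal[OF S(1)])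
    finally show ?thesis .
  qed
  have J_const: "J u = J v" if u: "norm u = 1" for u
  proof -
    obtain T where "orthogonal_transformation T" "T v = u"
      using orthogonal_transformation_exists[of v u] u v by auto
    then show ?thesis using J_inv[of T v] by simp
  qed
  note good = AE_gram_schmidt_all_nonzero[where 'n='n]
  have "J v = (\<integral>\<^sup>+ u. J v \<partial>?S)" by (simp add: S.emeasure_space_1[simplified])
  also have "\<dots> = (\<integral>\<^sup>+ u. J u \<partial>?S)"
    using AE_sphere_sigma by (intro nn_integral_cong_AE, eventually_elim) (simp add: J_const)
  also have "\<dots> = (\<integral>\<^sup>+ X. (\<integral>\<^sup>+ u. \<Phi> (frame_coords X u) \<partial>?S) \<partial>?P)"
    unfolding J_def using PS.Fubini'[OF meas] by simp
  \<comment> \<open>For a nondegenerate \<open>X\<close> the map \<open>u\<close> to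
    \<open>frame_coords X u\<close> is orthogonal, so the inner average no longer depends on
    \<open>X\<close>.\<close>
  also have "\<dots> = (\<integral>\<^sup>+ X. (\<integral>\<^sup>+ u. \<Phi> u \<partial>?S) \<partial>?P)"
    using good
    by (intro nn_integral_cong_AE, eventually_elim)
       (auto intro!: nn_integral_sphere_sigma_orthogonal frame_coords_orthogonal)
  also have "\<dots> = (\<integral>\<^sup>+ u. \<Phi> u \<partial>?S)" by (simp add: P.emeasure_space_1)
  finally show ?thesis by (simp add: J_def)
qed

text \<open>The frame consists of the columns \<open>frame_coords X (axis k 1)\<close> of a random
  orthogonal matrix with Gram--Schmidt rows. Each column has law \<open>sphere_sigma\<close>, so by
  linearity the expected sum is \<open>CARD('n)\<close> times one integral.\<close>

lemma nn_integral_sphere_ge_frame_bound: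
  fixes \<Phi> :: "real^'n::finite \<Rightarrow> ennreal"
  assumes \<Phi>[measurable]: "\<Phi> \<in> borel_measurable borel"
    and frames: "\<And>T :: real^'n \<Rightarrow> real^'n. orthogonal_transformation T \<Longrightarrow>
      of_nat CARD('n) * c \<le> (\<Sum>k\<in>UNIV. \<Phi> (T (axis k 1)))"
  shows "c \<le> (\<integral>\<^sup>+ x. \<Phi> x \<partial>sphere_sigma TYPE('n))"
proof -
  let ?P = "ball_seq CARD('n) :: (nat \<Rightarrow> real^'n) measure"
  interpret PP: product_prob_space "\<lambda>_::nat. unit_ball_unif :: (real^'n) measure"
    by (rule product_prob_space_unit_ball_unif)
  interpret P: prob_space ?P by (intro prob_space_PiM prob_space_unit_ball_unif)
  note good = AE_gram_schmidt_all_nonzero[where 'n='n]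
  have meas: "(\<lambda>X. \<Phi> (frame_coords X u)) \<in> borel_measurable ?P" for u
    using measurable_compose[OF measurable_Pair2'[of u borel ?P]
      measurable_compose[OF borel_measurable_frame_coords \<Phi>]] by simp
  have "of_nat CARD('n) * c = (\<integral>\<^sup>+ X. of_nat CARD('n) * c \<partial>?P)"
    by (simp add: P.emeasure_space_1)
  also have "\<dots> \<le> (\<integral>\<^sup>+ X. (\<Sum>k\<in>UNIV. \<Phi> (frame_coords X (axis k 1))) \<partial>?P)"
  proof (rule nn_integral_mono_AE)
    show "AE X in ?P. of_nat CARD('n) * c \<le> (\<Sum>k\<in>UNIV. \<Phi> (frame_coords X (axis k 1)))"
      using good by eventually_elim (rule frames[OF frame_coords_orthogonal], simp)
  qed
  also have "\<dots> = (\<Sum>k\<in>(UNIV::'n set). \<integral>\<^sup>+ x. \<Phi> x \<partial>sphere_sigma TYPE('n))"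
    by (subst nn_integral_sum) (auto simp: meas nn_integral_frame_coords)
  also have "\<dots> = of_nat CARD('n) * (\<integral>\<^sup>+ x. \<Phi> x \<partial>sphere_sigma TYPE('n))"
    by simp
  finally show ?thesis
    by (subst (asm) ennreal_mult_le_mult_iff) (use of_nat_less_top[of "CARD('n)"] in auto)
qed

section \<open>The inequality for a single frame\<close>

lemma enn_powr_ennreal: "x \<ge> 0 \<Longrightarrow> enn_powr (ennreal x) a = ennreal (x powr a)"
  by (simp add: enn_powr_def)

lemma enn_powr_mono:
  assumes "x \<le> y" "a \<ge> 0"
  shows "enn_powr x a \<le> enn_powr y a"
proof (cases "y = top")
  case False
  then have "enn2real x \<le> enn2real y" using assms(1)
    by (intro enn2real_mono) (auto simp: less_top)
  moreover have "x \<noteq> top" using False assms(1) by (auto simp: top_unique)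
  ultimately show ?thesis
    using False assms(2) by (simp add: enn_powr_def ennreal_leI powr_mono2)
qed (simp add: enn_powr_def)

lemma enn_powr_enn_powr: "enn_powr (enn_powr x a) b = enn_powr x (a * b)"
  by (simp add: enn_powr_def powr_powr)

lemma enn_powr_eq_0_iff: "enn_powr x a = 0 \<longleftrightarrow> x = 0"
  by (auto simp: enn_powr_def enn2real_eq_0_iff)

lemma enn_powr_eq_top_iff: "enn_powr x a = top \<longleftrightarrow> x = top"
  by (simp add: enn_powr_def)

lemma borel_measurable_enn_powr [measurable]:
  assumes [measurable]: "f \<in> borel_measurable M"
  shows "(\<lambda>x. enn_powr (f x) a) \<in> borel_measurable M"
  unfolding enn_powr_def by measurable

text \<open>Jensen's inequality for the concave power \<open>s = q0 / q\<close>, through its tangent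
  line at \<open>B\<close>: on a probability space the tangent integrates to exactly
  \<open>b powr s\<close>. As \<open>b\<close> is a divisor, the values 0 and \<infinity> of
  \<open>B\<close> are separate cases.\<close>

lemma Lp_qnorm_mono_exponent:
  assumes M: "prob_space M" and g[measurable]: "g \<in> borel_measurable M" and q: "0 < q0" "q0 \<le> q"
  shows "Lp_qnorm M q0 g \<le> Lp_qnorm M q g"
proof -
  interpret prob_space M by fact
  define B where "B = (\<integral>\<^sup>+ x. enn_powr (g x) q \<partial>M)"
  define s where "s = q0 / q"
  have s: "0 < s" "s \<le> 1" "q * s = q0" using q by (auto simp: s_def)
  have "(\<integral>\<^sup>+ x. enn_powr (g x) q0 \<partial>M) \<le> enn_powr B s"
  proof -
    consider "B = top" | "B = 0" | "B \<noteq> 0" "B \<noteq> top" by blast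
    then show ?thesis
    proof cases
      case 1
      then show ?thesis by (simp add: enn_powr_def)
    next
      case 2
      then have "AE x in M. enn_powr (g x) q = 0"
        unfolding B_def by (subst (asm) nn_integral_0_iff_AE) auto
      then have "AE x in M. enn_powr (g x) q0 = 0" by (simp add: enn_powr_eq_0_iff)
      then have "(\<integral>\<^sup>+ x. enn_powr (g x) q0 \<partial>M) = 0"
        by (subst nn_integral_0_iff_AE) auto
      then show ?thesis by simp
    next
      case 3
      define b where "b = enn2real B"
      have b: "b > 0" "B = ennreal b"
        using 3 by (auto simp: b_def enn2real_positive_iff zero_less_iff_neq_zero less_top)
      have pt: "enn_powr (g x) q0 \<le> ennreal (b powr s) * (ennreal (s / b) * enn_powr (g x) q + ennreal (1 - s))" for x
      proof (cases "g x = top")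
        case True
        then show ?thesis using b s by (simp add: enn_powr_def ennreal_mult_top ennreal_mult_eq_top_iff)
      next
        case False
        define y where "y = enn2real (g x)"
        have y: "y \<ge> 0" "g x = ennreal y" using False by (auto simp: y_def less_top)
        have "y powr q0 = b powr s * ((y powr q / b) powr s * 1 powr (1 - s))"
          using b s y by (simp add: powr_divide powr_powr)
        also have "\<dots> \<le> b powr s * (s * (y powr q / b) + (1 - s) * 1)"
        proof (intro mult_left_mono)
          show "(y powr q / b) powr s * 1 powr (1 - s) \<le> s * (y powr q / b) + (1 - s) * 1"
          proof (cases "y = 0")
            case False
            then show ?thesis using s b y by (intro Youngs_inequality_0) auto
          qed (use s in simp)
        qed auto
        finally have "ennreal (y powr q0) \<le> ennreal (b powr s * (s / b * y powr q + (1 - s)))"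
          by (intro ennreal_leI) simp
        also have "\<dots> = ennreal (b powr s) * (ennreal (s / b) * ennreal (y powr q) + ennreal (1 - s))"
          using s b by (simp only: ennreal_mult[symmetric] ennreal_plus[symmetric] ennreal_mult_eq_top_iff
              mult_nonneg_nonneg add_nonneg_nonneg less_imp_le divide_nonneg_pos powr_ge_zero diff_ge_0_iff_ge)
        finally show ?thesis by (simp add: y enn_powr_ennreal)
      qed
      have "(\<integral>\<^sup>+ x. enn_powr (g x) q0 \<partial>M)
          \<le> (\<integral>\<^sup>+ x. ennreal (b powr s) * (ennreal (s / b) * enn_powr (g x) q + ennreal (1 - s)) \<partial>M)"
        by (intro nn_integral_mono pt)
      also have "\<dots> = ennreal (b powr s) * (ennreal (s / b) * B + ennreal (1 - s))"
        by (simp add: nn_integral_cmult nn_integral_add B_def emeasure_space_1)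
      also have "\<dots> = ennreal (b powr s)"
      proof -
        have "ennreal (s / b) * B = ennreal s"
          using b s by (simp add: ennreal_mult'[symmetric])
        moreover have "ennreal s + ennreal (1 - s) = 1"
          using s by (simp add: ennreal_plus[symmetric] del: ennreal_plus)
        ultimately show ?thesis by simp
      qed
      finally show ?thesis using b by (simp add: enn_powr_ennreal)
    qed
  qed
  then have "Lp_qnorm M q0 g \<le> enn_powr (enn_powr B s) (1 / q0)"
    unfolding Lp_qnorm_def using q by (intro enn_powr_mono) auto
  also have "\<dots> = Lp_qnorm M q g"
    using q by (simp add: enn_powr_enn_powr Lp_qnorm_def B_def s_def)
  finally show ?thesis .
qed

text \<open>Hoelder's inequality in pointwise form: \<open>y powr p\<close> equals \<open>u powr p * v powr (1 - p)\<close>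
  with \<open>u = y * (\<Prod>k. (\<phi> k powr (q - 1) / a k) powr (1 / d))\<close> and
  \<open>v = (\<Prod>k. sqrt (\<phi> k powr q / a k))\<close>, up to the constant; the relation between \<open>p\<close> and \<open>q\<close>
  makes the powers of \<open>\<phi> k\<close> cancel.\<close>

lemma frame_pointwise_bound:
  fixes \<phi> a :: "'n::finite \<Rightarrow> real"
  assumes p: "0 < p" "p \<le> 1" and q: "0 < q"
    and pq: "1 / q - 1 = real CARD('n) / 2 * (1 / p - 1)"
    and y: "y > 0" and \<phi>: "\<And>k. \<phi> k > 0" and a: "\<And>k. a k > 0"
  shows "y powr p \<le> (\<Prod>k\<in>UNIV. a k powr (p / (q * real CARD('n)))) *
     (p * (y * (\<Sum>k\<in>UNIV. \<phi> k powr (q - 1) / a k / real CARD('n)))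
      + (1 - p) * (\<Prod>k\<in>UNIV. sqrt (\<phi> k powr q / a k)))"
proof -
  define d where "d = real CARD('n)"
  have d: "d > 0" by (simp add: d_def)
  define C where "C = (\<Prod>k\<in>UNIV. a k powr (p / (q * d)))"
  define G where "G = (\<lambda>k. \<phi> k powr (q - 1) / a k)"
  define H where "H = (\<lambda>k. \<phi> k powr q / a k)"
  have a0: "a k \<noteq> 0" and \<phi>0: "\<phi> k \<noteq> 0" for k using a[of k] \<phi>[of k] by auto
  have C: "C > 0" unfolding C_def using a0 by (intro prod_pos) auto
  have G: "G k > 0" and H: "H k > 0" for k using a[of k] \<phi>[of k] by (auto simp: G_def H_def)
  define g where "g = (\<Prod>k\<in>UNIV. G k)"
  define u where "u = y * g powr (1 / d)"
  define v where "v = (\<Prod>k\<in>UNIV. sqrt (H k))"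
  have g: "g > 0" unfolding g_def using G by (intro prod_pos) auto
  have u: "u > 0" using y g by (simp add: u_def)
  have v: "v > 0" unfolding v_def using H by (intro prod_pos) auto
  \<comment> \<open>\<open>e\<close> makes the powers of \<open>a k\<close> cancel. The same
    relation multiplied by \<open>q\<close> is \<open>e2\<close>, which does so for
    \<open>\<phi> k\<close>.\<close>
  have e: "p / (q * d) = p / d + (1 - p) / 2"
  proof -
    have "1 / q = 1 + d / 2 * (1 / p - 1)" using pq unfolding d_def by linarith
    then have "p / d * (1 / q) = p / d * (1 + d / 2 * (1 / p - 1))" by simp
    also have "\<dots> = p / d + (1 - p) / 2" using d p by (simp add: field_simps)
    finally show ?thesis by (simp add: mult.commute)
  qed
  have e2: "(q - 1) * (p / d) + q * ((1 - p) / 2) = 0"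
  proof -
    have "q * (p / (q * d)) = q * (p / d + (1 - p) / 2)" by (simp add: e)
    then show ?thesis using q d by (simp add: field_simps)
  qed
  have "y powr p = C * (u powr p * v powr (1 - p))"
  proof -
    have "ln (C * (u powr p * v powr (1 - p))) = ln C + (p * ln u + (1 - p) * ln v)"
      using C u v by (simp add: ln_mult ln_powr)
    also have "ln C = (\<Sum>k\<in>UNIV. p / (q * d) * ln (a k))"
      unfolding C_def using a0 by (subst ln_prod) (auto simp: ln_powr)
    also have "ln u = ln y + 1 / d * (\<Sum>k\<in>UNIV. (q - 1) * ln (\<phi> k) - ln (a k))"
    proof -
      have "ln g = (\<Sum>k\<in>UNIV. (q - 1) * ln (\<phi> k) - ln (a k))"
        unfolding g_def using G a a0 \<phi> \<phi>0 by (subst ln_prod) (auto simp: G_def ln_div ln_powr)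
      then show ?thesis using y g by (simp add: u_def ln_mult ln_powr)
    qed
    also have "ln v = (\<Sum>k\<in>UNIV. (q * ln (\<phi> k) - ln (a k)) / 2)"
    proof -
      have "ln (sqrt (H k)) = (q * ln (\<phi> k) - ln (a k)) / 2" for k
        using H[of k] a[of k] \<phi>[of k] by (simp add: ln_sqrt H_def ln_div ln_powr)
      moreover have "ln v = (\<Sum>k\<in>UNIV. ln (sqrt (H k)))"
        unfolding v_def using H by (intro ln_prod) (auto simp: less_imp_neq[symmetric])
      ultimately show ?thesis by (simp only:)
    qed
    also have "(\<Sum>k\<in>UNIV. p / (q * d) * ln (a k)) + (p * (ln y + 1 / d * (\<Sum>k\<in>UNIV. (q - 1) * ln (\<phi> k) - ln (a k)))
        + (1 - p) * (\<Sum>k\<in>UNIV. (q * ln (\<phi> k) - ln (a k)) / 2))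
      = p * ln y + (\<Sum>k\<in>UNIV. p / (q * d) * ln (a k) + (p / d * ((q - 1) * ln (\<phi> k) - ln (a k))
        + (1 - p) * ((q * ln (\<phi> k) - ln (a k)) / 2)))"
      by (simp add: sum.distrib sum_distrib_left distrib_left)
    also have "(\<Sum>k\<in>UNIV. p / (q * d) * ln (a k) + (p / d * ((q - 1) * ln (\<phi> k) - ln (a k))
        + (1 - p) * ((q * ln (\<phi> k) - ln (a k)) / 2))) = 0"
    proof (rule sum.neutral, intro ballI)
      fix k
      have "p / (q * d) * ln (a k) + (p / d * ((q - 1) * ln (\<phi> k) - ln (a k))
          + (1 - p) * ((q * ln (\<phi> k) - ln (a k)) / 2))
        = (p / (q * d) - (p / d + (1 - p) / 2)) * ln (a k) + ((q - 1) * (p / d) + q * ((1 - p) / 2)) * ln (\<phi> k)"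
      proof -
        have "E * x + (P * ((q - 1) * z - x) + r * (q * z - x)) = (E - (P + r)) * x + ((q - 1) * P + q * r) * z"
          for E P r x z :: real by (simp add: algebra_simps)
        from this[of "p / (q * d)" "ln (a k)" "p / d" "ln (\<phi> k)" "(1 - p) / 2"]
        show ?thesis by simp
      qed
      then show "p / (q * d) * ln (a k) + (p / d * ((q - 1) * ln (\<phi> k) - ln (a k))
          + (1 - p) * ((q * ln (\<phi> k) - ln (a k)) / 2)) = 0"
        by (simp only: e e2) simp
    qed
    finally have "ln (C * (u powr p * v powr (1 - p))) = ln (y powr p)"
      using y by (simp add: ln_powr)
    then show ?thesis using C u v y by (subst (asm) ln_inj_iff) auto
  qed
  also have "\<dots> \<le> C * (p * u + (1 - p) * v)"
    using p u v C by (intro mult_left_mono Youngs_inequality_0) auto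
  also have "\<dots> \<le> C * (p * (y * (\<Sum>k\<in>UNIV. G k / d)) + (1 - p) * v)"
  proof -
    have "u \<le> y * (\<Sum>k\<in>UNIV. G k / d)"
      unfolding u_def g_def d_def using y G
      by (intro mult_left_mono arith_geom_mean) (auto simp: less_imp_le)
    then show ?thesis using p C by (simp add: mult_left_mono)
  qed
  finally show ?thesis by (simp add: C_def G_def H_def v_def d_def)
qed

text \<open>After division by \<open>a k\<close>, every integral in the pointwise bound is at most
  1: those of \<open>G k\<close> against \<open>f\<close> by duality, that of the product of the
  \<open>H k\<close> by \<open>spherical_Brascamp_Lieb\<close>. The weights \<open>p\<close> and
  \<open>1 - p\<close> add up to 1, so the constant \<open>C\<close> alone bounds
  \<open>I\<close>.\<close>

lemma frame_inequality:
  fixes f :: "real^'n \<Rightarrow> real" and F :: "'n::finite \<Rightarrow> real \<Rightarrow> ennreal"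
    and T :: "real^'n \<Rightarrow> real^'n"
  assumes d2: "CARD('n) \<ge> 2"
    and p: "0 < p" "p \<le> 1" and q: "0 < q"
    and pq: "1 / q - 1 = real CARD('n) / 2 * (1 / p - 1)"
    and f[measurable]: "f \<in> borel_measurable borel" and f0: "\<And>x. f x \<ge> 0"
    and T: "orthogonal_transformation T"
    and F[measurable]: "\<And>k. F k \<in> borel_measurable borel"
    and marginal: "\<And>k (g :: real \<Rightarrow> ennreal). g \<in> borel_measurable borel \<Longrightarrow>
      (\<integral>\<^sup>+ t. F k t * g t \<partial>nu_meas CARD('n))
        = (\<integral>\<^sup>+ x. ennreal (f x) * g (x \<bullet> T (axis k 1)) \<partial>sphere_sigma TYPE('n))"
  shows "of_nat CARD('n) * enn_powr (\<integral>\<^sup>+ x. enn_powr (ennreal (f x)) p \<partial>sphere_sigma TYPE('n)) (q / p)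
    \<le> (\<Sum>k\<in>UNIV. \<integral>\<^sup>+ t. enn_powr (F k t) q \<partial>nu_meas CARD('n))"
proof -
  let ?S = "sphere_sigma TYPE('n)" and ?nu = "nu_meas CARD('n)"
  define d where "d = real CARD('n)"
  have d: "d > 0" by (simp add: d_def)
  define A where "A = (\<lambda>k. \<integral>\<^sup>+ t. enn_powr (F k t) q \<partial>?nu)"
  define I where "I = (\<integral>\<^sup>+ x. enn_powr (ennreal (f x)) p \<partial>?S)"
  define e where "e = (\<lambda>k::'n. T (axis k 1))"
  have e_meas[measurable]: "(\<lambda>x. x \<bullet> e k) \<in> borel_measurable borel" for k by measurable
  have marginal_e: "(\<integral>\<^sup>+ t. F k t * g t \<partial>?nu) = (\<integral>\<^sup>+ x. ennreal (f x) * g (x \<bullet> e k) \<partial>?S)"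
    if "g \<in> borel_measurable borel" for k g
    unfolding e_def using that by (rule marginal)
  have I_eq: "I = (\<integral>\<^sup>+ x. ennreal (f x powr p) \<partial>?S)"
    by (simp add: I_def enn_powr_ennreal f0)
  consider (trivial) "I = 0" | (infinite) k where "A k = top" | (zero) k where "A k = 0"
    | (main) "\<And>k. A k \<noteq> 0 \<and> A k \<noteq> top"
    by blast
  then have "of_nat CARD('n) * enn_powr I (q / p) \<le> (\<Sum>k\<in>UNIV. A k)"
  proof cases
    case trivial
    then show ?thesis by (simp add: enn_powr_def)
  next
    case infinite
    have "A k \<le> (\<Sum>k\<in>UNIV. A k)" by (intro member_le_sum) auto
    with infinite have "(\<Sum>k\<in>UNIV. A k) = top" by (simp add: top_unique)
    then show ?thesis by (simp only: top_greatest)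
  next
    \<comment> \<open>Here \<open>F k\<close> vanishes almost everywhere, and duality with the
      constant 1 forces \<open>f\<close> to vanish almost everywhere.\<close>
    case zero
    then have "AE t in ?nu. enn_powr (F k t) q = 0"
      unfolding A_def by (subst (asm) nn_integral_0_iff_AE) auto
    then have "AE t in ?nu. F k t * 1 = 0" by (simp add: enn_powr_eq_0_iff)
    then have "(\<integral>\<^sup>+ t. F k t * 1 \<partial>?nu) = 0" by (subst nn_integral_0_iff_AE) auto
    then have "(\<integral>\<^sup>+ x. ennreal (f x) * 1 \<partial>?S) = 0" using marginal_e[of "\<lambda>_. 1" k] by simp
    then have "AE x in ?S. ennreal (f x) = 0" by (subst (asm) nn_integral_0_iff_AE) auto
    then have "AE x in ?S. ennreal (f x powr p) = 0"
      by eventually_elim (use f0 in \<open>auto simp: ennreal_eq_0_iff intro: antisym\<close>)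
    then have "I = 0" unfolding I_eq by (subst nn_integral_0_iff_AE) auto
    then show ?thesis by (simp add: enn_powr_def)
  next
    case main
    define a where "a = (\<lambda>k. enn2real (A k))"
    have a: "a k > 0" and Aa: "A k = ennreal (a k)" for k
      using main[of k] by (auto simp: a_def enn2real_positive_iff zero_less_iff_neq_zero less_top)
    \<comment> \<open>\<open>enn2real\<close> turns the value \<infinity> into 0. This happens only
      on a null set because \<open>A k\<close> is finite.\<close>
    define \<phi> where "\<phi> = (\<lambda>k t. enn2real (F k t))"
    have \<phi>0: "\<phi> k t \<ge> 0" for k t by (simp add: \<phi>_def)
    have \<phi>_meas[measurable]: "\<phi> k \<in> borel_measurable borel" for k unfolding \<phi>_def by measurable
    define G where "G = (\<lambda>k t. \<phi> k t powr (q - 1) / a k)"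
    define H where "H = (\<lambda>k t. \<phi> k t powr q / a k)"
    have [measurable]: "G k \<in> borel_measurable borel" "H k \<in> borel_measurable borel" for k
      unfolding G_def H_def by measurable
    have G0: "G k t \<ge> 0" and H0: "H k t \<ge> 0" for k t
      using a[of k] by (auto simp: G_def H_def)
    have fin: "AE t in ?nu. F k t \<noteq> top" for k
    proof -
      have "AE t in ?nu. enn_powr (F k t) q \<noteq> \<infinity>"
        by (rule nn_integral_noteq_infinite) (use main[of k] in \<open>auto simp: A_def\<close>)
      then show ?thesis by (simp add: enn_powr_eq_top_iff)
    qed
    have H1: "(\<integral>\<^sup>+ t. ennreal (H k t) \<partial>?nu) \<le> 1" for k
    proof -
      have "(\<integral>\<^sup>+ t. ennreal (H k t) \<partial>?nu) \<le> (\<integral>\<^sup>+ t. ennreal (1 / a k) * enn_powr (F k t) q \<partial>?nu)"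
      proof (rule nn_integral_mono)
        fix t
        show "ennreal (H k t) \<le> ennreal (1 / a k) * enn_powr (F k t) q"
          using a[of k]
          by (auto simp: enn_powr_def H_def \<phi>_def ennreal_mult_eq_top_iff ennreal_mult_top ennreal_mult'[symmetric])
      qed
      also have "\<dots> = ennreal (1 / a k) * ennreal (a k)"
        by (subst nn_integral_cmult) (auto simp: A_def simp flip: Aa)
      also have "\<dots> = 1" using a[of k] by (simp add: ennreal_mult'[symmetric])
      finally show ?thesis .
    qed
    have fG: "(\<integral>\<^sup>+ x. ennreal (f x) * ennreal (G k (x \<bullet> e k)) \<partial>?S) \<le> 1" for k
    proof -
      have "(\<integral>\<^sup>+ x. ennreal (f x) * ennreal (G k (x \<bullet> e k)) \<partial>?S) = (\<integral>\<^sup>+ t. F k t * ennreal (G k t) \<partial>?nu)"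
        using marginal_e[of "\<lambda>t. ennreal (G k t)" k] by simp
      also have "\<dots> = (\<integral>\<^sup>+ t. ennreal (H k t) \<partial>?nu)"
      proof (rule nn_integral_cong_AE)
        show "AE t in ?nu. F k t * ennreal (G k t) = ennreal (H k t)"
          using fin[of k]
        proof eventually_elim
          case (elim t)
          then have "F k t = ennreal (\<phi> k t)" by (simp add: \<phi>_def less_top)
          \<comment> \<open>At 0 both sides are 0, as \<open>0 powr x = 0\<close> even for negative
            \<open>x\<close>.\<close>
          moreover have "\<phi> k t * (\<phi> k t powr (q - 1)) = \<phi> k t powr q"
            using \<phi>0[of k t] by (cases "\<phi> k t = 0") (simp_all add: powr_diff)
          ultimately show ?case
            using \<phi>0[of k t] by (simp add: G_def H_def ennreal_mult'[symmetric])
        qed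
      qed
      finally show ?thesis using H1[of k] by simp
    qed
    \<comment> \<open>Because the weight is 0 and not \<infinity> where the marginal vanishes, the
      pointwise bound requires \<open>\<phi> k > 0\<close> wherever \<open>f > 0\<close>. Duality
      with the indicator of the zero set shows that this fails only on a null set.\<close>
    have pos: "AE x in ?S. f x > 0 \<longrightarrow> \<phi> k (x \<bullet> e k) > 0" for k
    proof -
      define Z where "Z = {t. \<phi> k t = 0}"
      have [measurable]: "Z \<in> sets borel" unfolding Z_def by measurable
      have "(\<integral>\<^sup>+ x. ennreal (f x) * indicator Z (x \<bullet> e k) \<partial>?S) = (\<integral>\<^sup>+ t. F k t * indicator Z t \<partial>?nu)"
        using marginal_e[of "indicator Z" k] by simp
      also have "\<dots> = (\<integral>\<^sup>+ t. 0 \<partial>?nu)"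
        using fin[of k]
        by (intro nn_integral_cong_AE, eventually_elim)
          (auto simp: Z_def \<phi>_def indicator_def enn2real_eq_0_iff)
      finally have "(\<integral>\<^sup>+ x. ennreal (f x) * indicator Z (x \<bullet> e k) \<partial>?S) = 0" by simp
      then have "AE x in ?S. ennreal (f x) * indicator Z (x \<bullet> e k) = 0"
        by (subst (asm) nn_integral_0_iff_AE) auto
      then show ?thesis
        by eventually_elim (use \<phi>0 in \<open>auto simp: Z_def indicator_def less_le split: if_splits\<close>)
    qed
    \<comment> \<open>Rotation invariance carries the frame back to the coordinate axes.\<close>
    have prod_H: "(\<integral>\<^sup>+ x. ennreal (\<Prod>k\<in>UNIV. sqrt (H k (x \<bullet> e k))) \<partial>?S) \<le> 1"
    proof -
      have "T x \<bullet> e k = x $ k" for x k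
        using T by (simp add: e_def orthogonal_transformation_def inner_axis)
      moreover have "(\<integral>\<^sup>+ x. ennreal (\<Prod>k\<in>UNIV. sqrt (H k (x \<bullet> e k))) \<partial>?S)
        = (\<integral>\<^sup>+ x. ennreal (\<Prod>k\<in>UNIV. sqrt (H k (T x \<bullet> e k))) \<partial>?S)"
        by (rule nn_integral_sphere_sigma_orthogonal[OF T, symmetric]) measurable
      ultimately show ?thesis
        using spherical_Brascamp_Lieb[OF d2 _ H0 H1] by simp
    qed
    define C where "C = (\<Prod>k\<in>(UNIV::'n set). a k powr (p / (q * d)))"
    have C: "C \<ge> 0" unfolding C_def by (intro prod_nonneg) auto
    have "I \<le> (\<integral>\<^sup>+ x. ennreal C * (ennreal (p / d) * (\<Sum>k\<in>UNIV. ennreal (f x) * ennreal (G k (x \<bullet> e k)))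
        + ennreal (1 - p) * ennreal (\<Prod>k\<in>UNIV. sqrt (H k (x \<bullet> e k)))) \<partial>?S)"
      unfolding I_eq
    proof (rule nn_integral_mono_AE)
      have "AE x in ?S. \<forall>k\<in>UNIV. f x > 0 \<longrightarrow> \<phi> k (x \<bullet> e k) > 0"
        by (subst AE_finite_all) (auto simp: pos)
      then show "AE x in ?S. ennreal (f x powr p)
          \<le> ennreal C * (ennreal (p / d) * (\<Sum>k\<in>UNIV. ennreal (f x) * ennreal (G k (x \<bullet> e k)))
            + ennreal (1 - p) * ennreal (\<Prod>k\<in>UNIV. sqrt (H k (x \<bullet> e k))))"
      proof eventually_elim
        case (elim x)
        define s where "s = (\<Sum>k\<in>UNIV. G k (x \<bullet> e k))"
        define v where "v = (\<Prod>k\<in>UNIV. sqrt (H k (x \<bullet> e k)))"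
        have s: "s \<ge> 0" unfolding s_def by (intro sum_nonneg G0)
        have v: "v \<ge> 0" unfolding v_def by (intro prod_nonneg) (simp add: H0)
        have "(\<Sum>k\<in>UNIV. ennreal (f x) * ennreal (G k (x \<bullet> e k))) = ennreal (f x * s)"
          unfolding s_def sum_distrib_left
          by (subst sum_ennreal[symmetric]) (auto simp: f0 G0 ennreal_mult)
        then have R: "ennreal C * (ennreal (p / d) * (\<Sum>k\<in>UNIV. ennreal (f x) * ennreal (G k (x \<bullet> e k)))
            + ennreal (1 - p) * ennreal (\<Prod>k\<in>UNIV. sqrt (H k (x \<bullet> e k))))
          = ennreal (C * (p / d * (f x * s) + (1 - p) * v))"
          using C p d s v f0[of x]
          by (simp add: ennreal_mult[symmetric] ennreal_plus[symmetric] v_def[symmetric] del: ennreal_plus)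
        show ?case
        proof (cases "f x > 0")
          case False
          then have "f x = 0" using f0[of x] by simp
          then show ?thesis by simp
        next
          case True
          have "f x powr p \<le> C * (p * (f x * (\<Sum>k\<in>UNIV. \<phi> k (x \<bullet> e k) powr (q - 1) / a k / d)) + (1 - p) * v)"
            unfolding C_def d_def v_def H_def
            by (rule frame_pointwise_bound[OF p q pq True]) (use elim True a in auto)
          also have "(\<Sum>k\<in>UNIV. \<phi> k (x \<bullet> e k) powr (q - 1) / a k / d) = s / d"
            by (simp add: s_def G_def sum_divide_distrib)
          finally have "f x powr p \<le> C * (p / d * (f x * s) + (1 - p) * v)"
            by (simp add: mult_ac)
          then show ?thesis unfolding R by (rule ennreal_leI)
        qed
      qed
    qed
    also have "\<dots> = ennreal C * (ennreal (p / d) * (\<Sum>k\<in>UNIV. \<integral>\<^sup>+ x. ennreal (f x) * ennreal (G k (x \<bullet> e k)) \<partial>?S)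
        + ennreal (1 - p) * (\<integral>\<^sup>+ x. ennreal (\<Prod>k\<in>UNIV. sqrt (H k (x \<bullet> e k))) \<partial>?S))"
      by (simp add: nn_integral_cmult nn_integral_add nn_integral_sum)
    also have "\<dots> \<le> ennreal C * (ennreal (p / d) * (\<Sum>k\<in>(UNIV::'n set). 1) + ennreal (1 - p) * 1)"
      by (intro mult_left_mono add_mono sum_mono fG prod_H) auto
    also have "\<dots> = ennreal C"
    proof -
      have "ennreal (p / d) * (\<Sum>k\<in>(UNIV::'n set). 1) = ennreal (p / d) * ennreal d"
        by (simp add: d_def ennreal_of_nat_eq_real_of_nat)
      also have "\<dots> = ennreal p" using p d by (simp add: ennreal_mult'[symmetric])
      finally have "ennreal (p / d) * (\<Sum>k\<in>(UNIV::'n set). 1) + ennreal (1 - p) * 1 = 1"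
        using p by (simp add: ennreal_plus[symmetric] del: ennreal_plus)
      then show ?thesis by simp
    qed
    finally have "enn_powr I (q / p) \<le> enn_powr (ennreal C) (q / p)"
      using p q by (intro enn_powr_mono) auto
    also have "\<dots> = ennreal (C powr (q / p))" using C by (rule enn_powr_ennreal)
    \<comment> \<open>The exponent of \<open>C\<close> is such that the geometric mean of the
      \<open>a k\<close> appears; the arithmetic mean then bounds it by a quantity linear in the
      integrals.\<close>
    also have "C powr (q / p) = (\<Prod>k\<in>UNIV. a k) powr (1 / d)"
    proof -
      have "C = (\<Prod>k\<in>UNIV. a k) powr (p / (q * d))"
        unfolding C_def by (intro prod_powr_distrib[symmetric])
      then show ?thesis using p q d by (simp add: powr_powr)
    qed
    also have "ennreal ((\<Prod>k\<in>UNIV. a k) powr (1 / d)) \<le> ennreal (\<Sum>k\<in>UNIV. a k / d)"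
      unfolding d_def using a by (intro ennreal_leI arith_geom_mean) (auto simp: less_imp_le)
    finally have "of_nat CARD('n) * enn_powr I (q / p) \<le> of_nat CARD('n) * ennreal (\<Sum>k\<in>UNIV. a k / d)"
      by (intro mult_left_mono) auto
    also have "\<dots> = ennreal d * ennreal (\<Sum>k\<in>UNIV. a k / d)"
      by (simp add: d_def ennreal_of_nat_eq_real_of_nat)
    also have "\<dots> = ennreal (\<Sum>k\<in>UNIV. a k)"
      using d by (subst ennreal_mult'[symmetric]) (auto simp: sum_divide_distrib[symmetric])
    also have "\<dots> = (\<Sum>k\<in>UNIV. A k)"
      unfolding Aa using a by (intro sum_ennreal[symmetric]) (auto simp: less_imp_le)
    finally show ?thesis .
  qed
  then show ?thesis by (simp add: A_def I_def)
qed

section \<open>The endpoint exponent and averaging over frames\<close>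

theorem theorem9p5:
  fixes f :: "real^'n \<Rightarrow> real"
    and R :: "real^'n \<Rightarrow> real \<Rightarrow> ennreal"
    and p q :: real
  assumes d2: "CARD('n) \<ge> 2"
    and p: "0 < p" "p \<le> 1"
    and q: "0 < q" "q \<le> 1"
    and pq: "(1 / real CARD('n)) * (1 - 1 / q) \<ge> (1 / 2) * (1 - 1 / p)"
    and f_meas: "f \<in> borel_measurable borel"
    and f_nonneg: "\<And>x. f x \<ge> 0"
    and R_meas: "(\<lambda>(t, \<omega>). R \<omega> t) \<in> borel_measurable (nu_meas CARD('n) \<Otimes>\<^sub>M sphere_sigma TYPE('n))"
    and R_def: "\<And>\<omega> (g :: real \<Rightarrow> ennreal). \<omega> \<in> sphere 0 1 \<Longrightarrow> g \<in> borel_measurable borel \<Longrightarrow>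
        (\<integral>\<^sup>+ t. R \<omega> t * g t \<partial>nu_meas CARD('n))
          = (\<integral>\<^sup>+ x. ennreal (f x) * g (x \<bullet> \<omega>) \<partial>sphere_sigma TYPE('n))"
  shows "Lp_qnorm (nu_meas CARD('n) \<Otimes>\<^sub>M sphere_sigma TYPE('n)) q (\<lambda>(t, \<omega>). R \<omega> t)
           \<ge> Lp_qnorm (sphere_sigma TYPE('n)) p (\<lambda>x. ennreal (f x))"
proof -
  let ?S = "sphere_sigma TYPE('n)" and ?nu = "nu_meas CARD('n)"
  interpret S: prob_space ?S by (rule prob_space_sphere_sigma)
  interpret nu: prob_space ?nu by (rule prob_space_nu_meas[OF d2])
  interpret NS: pair_prob_space ?nu ?S ..
  define d where "d = real CARD('n)"
  have d: "d > 0" by (simp add: d_def)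
  define m where "m = d / 2 * (1 / p - 1)"
  have m: "m \<ge> 0" using p d by (simp add: m_def)
  \<comment> \<open>The endpoint exponent belonging to \<open>p\<close>, from solving
    \<open>1 / q0 - 1 = m\<close>; the hypothesis on the exponents amounts to
    \<open>q0 \<le> q\<close>.\<close>
  define q0 where "q0 = 1 / (1 + m)"
  have q0: "q0 > 0" "1 / q0 - 1 = d / 2 * (1 / p - 1)" using m unfolding m_def[symmetric] by (auto simp: q0_def)
  have "1 / q - 1 \<le> d / 2 * (1 / p - 1)"
  proof -
    have "d * (1 / 2 * (1 - 1 / p)) \<le> d * (1 / d * (1 - 1 / q))"
      using pq d by (intro mult_left_mono) (auto simp: d_def)
    moreover have "d * (1 / d * (1 - 1 / q)) = 1 - 1 / q" using d by simp
    moreover have "d / 2 * (r - 1) = - (d * (1 / 2 * (1 - r)))" for r by (simp add: field_simps)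
    ultimately show ?thesis by (metis minus_diff_eq neg_le_iff_le)
  qed
  then have "1 / q \<le> 1 / q0" using q0 by linarith
  then have q0q: "q0 \<le> q" using q q0 by (simp add: field_simps)
  \<comment> \<open>The \<open>q0\<close>-th power of the quasi-norm of \<open>f\<close>, the form
    in which the bound for one frame is linear in the integrals \<open>A\<close> and can be
    averaged.\<close>
  define c where "c = enn_powr (\<integral>\<^sup>+ x. enn_powr (ennreal (f x)) p \<partial>?S) (q0 / p)"
  have Rq_meas: "(\<lambda>z. enn_powr (case z of (t, \<omega>) \<Rightarrow> R \<omega> t) q0) \<in> borel_measurable (?nu \<Otimes>\<^sub>M ?S)"
    using R_meas by measurable
  define A where "A = (\<lambda>\<omega>. \<integral>\<^sup>+ t. enn_powr (R \<omega> t) q0 \<partial>?nu)"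
  have A_meas: "A \<in> borel_measurable borel"
  proof -
    have "(\<lambda>z. enn_powr (R (fst z) (snd z)) q0) \<in> borel_measurable (?S \<Otimes>\<^sub>M ?nu)"
      using measurable_pair_swap[OF Rq_meas] by (simp add: case_prod_beta')
    from nu.borel_measurable_nn_integral_fst[OF this] show ?thesis
      by (simp add: A_def)
  qed
  have sec: "R \<omega> \<in> borel_measurable borel" for \<omega>
    using measurable_compose[OF measurable_Pair2'[of \<omega> ?S ?nu] R_meas] by simp
  have "c \<le> (\<integral>\<^sup>+ \<omega>. A \<omega> \<partial>?S)"
  proof (rule nn_integral_sphere_ge_frame_bound[OF A_meas])
    fix T :: "real^'n \<Rightarrow> real^'n" assume T: "orthogonal_transformation T"
    have unit: "T (axis k 1) \<in> sphere 0 1" for k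
      using T by (simp add: orthogonal_transformation norm_axis_1)
    show "of_nat CARD('n) * c \<le> (\<Sum>k\<in>UNIV. A (T (axis k 1)))"
      unfolding c_def A_def
      by (rule frame_inequality[OF d2 p q0(1) q0(2)[unfolded d_def] f_meas f_nonneg T])
         (auto intro: sec R_def unit)
  qed
  also have "\<dots> = (\<integral>\<^sup>+ z. enn_powr (case z of (t, \<omega>) \<Rightarrow> R \<omega> t) q0 \<partial>(?nu \<Otimes>\<^sub>M ?S))"
    unfolding A_def using NS.nn_integral_snd[OF Rq_meas] by simp
  finally have "enn_powr c (1 / q0) \<le> Lp_qnorm (?nu \<Otimes>\<^sub>M ?S) q0 (\<lambda>(t, \<omega>). R \<omega> t)"
    unfolding Lp_qnorm_def using q0 by (intro enn_powr_mono) auto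
  also have "enn_powr c (1 / q0) = Lp_qnorm ?S p (\<lambda>x. ennreal (f x))"
    using q0 by (simp add: c_def enn_powr_enn_powr Lp_qnorm_def)
  also have "Lp_qnorm (?nu \<Otimes>\<^sub>M ?S) q0 (\<lambda>(t, \<omega>). R \<omega> t) \<le> Lp_qnorm (?nu \<Otimes>\<^sub>M ?S) q (\<lambda>(t, \<omega>). R \<omega> t)"
    by (rule Lp_qnorm_mono_exponent[OF NS.prob_space_axioms R_meas q0(1) q0q])
  finally show ?thesis .
qed

end
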